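(* Let $D(\Gamma)$ be an irreducible Dyer group, and suppose that there exists some $v \in V(\Gamma)$ with $f(v) \neq 2$. Then either $\Gamma$ is a single vertex and $D(\Gamma)$ is cyclic, or $D(\Gamma)$ has trivial centre.
   Context: A Dyer graph is a finite simplicial graph $\Gamma$ with vertex set $V(\Gamma)$ and edge set $E(\Gamma)$, together with a vertex labelling $f : V(\Gamma) \to \mathbb{N}_{\geq 2}\cup\{\infty\}$ and an edge labelling $m : E(\Gamma) \to \mathbb{N}_{\geq 2}$ such that for every edge $\{u,v\}\in E(\Gamma)$, if $f(v)\geq 3$ (including $f(v)=\infty$) then $m(u,v)=2$. The associated Dyer group $D(\Gamma)$ is the group with generating set $V(\Gamma)$ and relations $v^{f(v)}=1$ for all $v\in V(\Gamma)$ with $f(v)<\infty$, and $\underbrace{uvu\cdots}_{m(u,v)\text{ terms}} = \underbrace{vuv\cdots}_{m(u,v)\text{ terms}}$ for all $\{u,v\}\in E(\Gamma)$. The Dyer graph $\Gamma$ (and the Dyer group $D(\Gamma)$) is called reducible if $\Gamma$ is the join of two (nonempty) induced subgraphs such that every edge $e$ of the join (i.e. every edge between the two subgraphs) satisfies $m(e)=2$; otherwise it is called irreducible. *)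

theory Defs
  imports "HOL-Algebra.Elementary_Groups" "HOL-Library.Extended_Nat"
begin

text \<open>The letter \<open>(s, True)\<close> stands for the generator \<open>s\<close> and \<open>(s, False)\<close> for its formal inverse.
  A pair \<open>(r, r')\<close> in \<open>R\<close> is the relation \<open>r = r'\<close>.\<close>

type_synonym 'a gword = "('a \<times> bool) list"

definition gwords :: "'a set \<Rightarrow> 'a gword set" where
  "gwords S = lists (S \<times> UNIV)"

inductive pres_eq :: "'a set \<Rightarrow> ('a gword \<times> 'a gword) set \<Rightarrow> 'a gword \<Rightarrow> 'a gword \<Rightarrow> bool"
  for S :: "'a set" and R :: "('a gword \<times> 'a gword) set" where
  refl: "w \<in> gwords S \<Longrightarrow> pres_eq S R w w"
| sym: "pres_eq S R u w \<Longrightarrow> pres_eq S R w u"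
| trans: "pres_eq S R u v \<Longrightarrow> pres_eq S R v w \<Longrightarrow> pres_eq S R u w"
| cancel: "u \<in> gwords S \<Longrightarrow> w \<in> gwords S \<Longrightarrow> s \<in> S \<Longrightarrow>
     pres_eq S R (u @ [(s, b), (s, \<not> b)] @ w) (u @ w)"
| relation: "u \<in> gwords S \<Longrightarrow> w \<in> gwords S \<Longrightarrow> (r, r') \<in> R \<Longrightarrow> r \<in> gwords S \<Longrightarrow> r' \<in> gwords S \<Longrightarrow>
     pres_eq S R (u @ r @ w) (u @ r' @ w)"

definition pres_rel :: "'a set \<Rightarrow> ('a gword \<times> 'a gword) set \<Rightarrow> ('a gword \<times> 'a gword) set" where
  "pres_rel S R = {(u, w). pres_eq S R u w}"

definition presented_group :: "'a set \<Rightarrow> ('a gword \<times> 'a gword) set \<Rightarrow> 'a gword set monoid" where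
  "presented_group S R =
     \<lparr>carrier = gwords S // pres_rel S R,
      mult = (\<lambda>X Y. \<Union>x\<in>X. \<Union>y\<in>Y. pres_rel S R `` {x @ y}),
      one = pres_rel S R `` {[]}\<rparr>"

definition inv_word :: "'a gword \<Rightarrow> 'a gword" where
  "inv_word w = rev (map (\<lambda>(s, b). (s, \<not> b)) w)"

lemma gwords_Nil [simp]: "[] \<in> gwords S"
  and gwords_Cons [simp]: "x # w \<in> gwords S \<longleftrightarrow> fst x \<in> S \<and> w \<in> gwords S"
  and gwords_append [simp]: "u @ w \<in> gwords S \<longleftrightarrow> u \<in> gwords S \<and> w \<in> gwords S"
  by (cases x; auto simp: gwords_def)+

lemma gwords_inv_word [simp]: "w \<in> gwords S \<Longrightarrow> inv_word w \<in> gwords S"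
  by (induction w) (auto simp: inv_word_def split: prod.splits)

lemma pres_eq_gwords:
  assumes "pres_eq S R u w"
  shows "u \<in> gwords S" "w \<in> gwords S"
  using assms by (induction) auto

lemma equiv_pres_rel: "equiv (gwords S) (pres_rel S R)"
  by (rule equivI)
    (auto simp: pres_rel_def refl_on_def sym_def trans_def
      intro: pres_eq.refl pres_eq.sym pres_eq.trans dest: pres_eq_gwords)

lemma pres_eq_context:
  assumes "pres_eq S R u w" "a \<in> gwords S" "b \<in> gwords S"
  shows "pres_eq S R (a @ u @ b) (a @ w @ b)"
  using assms
proof (induction)
  case (cancel u w s c)
  then show ?case using pres_eq.cancel[of "a @ u" S "w @ b" s R c] by simp
next
  case (relation u w r r')
  then show ?case using pres_eq.relation[of "a @ u" S "w @ b" r r' R] by simp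
qed (auto intro: pres_eq.refl pres_eq.sym pres_eq.trans)

lemma pres_eq_append:
  assumes "pres_eq S R u u'" "pres_eq S R w w'"
  shows "pres_eq S R (u @ w) (u' @ w')"
proof -
  have "pres_eq S R ([] @ u @ w) ([] @ u' @ w)" "pres_eq S R (u' @ w @ []) (u' @ w' @ [])"
    using assms by (intro pres_eq_context; auto dest: pres_eq_gwords)+
  then show ?thesis by (auto intro: pres_eq.trans)
qed

lemma pres_mult_class:
  assumes "u \<in> gwords S" "w \<in> gwords S"
  shows "(pres_rel S R `` {u}) \<otimes>\<^bsub>presented_group S R\<^esub> (pres_rel S R `` {w}) = pres_rel S R `` {u @ w}"
proof -
  have "pres_rel S R `` {x @ y} = pres_rel S R `` {u @ w}"
    if "x \<in> pres_rel S R `` {u}" "y \<in> pres_rel S R `` {w}" for x y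
    using that pres_eq_append[of S R u x w y]
    by (intro equiv_class_eq[OF equiv_pres_rel]) (auto simp: pres_rel_def intro: pres_eq.sym)
  moreover have "u \<in> pres_rel S R `` {u}" "w \<in> pres_rel S R `` {w}"
    using assms by (auto simp: pres_rel_def intro: pres_eq.refl)
  ultimately show ?thesis
    unfolding presented_group_def monoid.simps by blast
qed

lemma pres_eq_inv_word: "w \<in> gwords S \<Longrightarrow> pres_eq S R (inv_word w @ w) []"
proof (induction w)
  case Nil
  then show ?case by (simp add: inv_word_def pres_eq.refl)
next
  case (Cons x w)
  obtain s b where x: "x = (s, b)" by (cases x)
  have "pres_eq S R (inv_word w @ [(s, \<not> b), (s, \<not> \<not> b)] @ w) (inv_word w @ w)"
    using Cons.prems x by (intro pres_eq.cancel) auto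
  then show ?case using Cons x by (auto simp: inv_word_def intro: pres_eq.trans)
qed

theorem group_presented_group: "group (presented_group S R)"
proof (rule groupI)
  let ?G = "presented_group S R" and ?c = "\<lambda>w. pres_rel S R `` {w}"
  have carr: "carrier ?G = ?c ` gwords S"
    by (auto simp: presented_group_def quotient_def)
  have one: "\<one>\<^bsub>?G\<^esub> = ?c []" by (simp add: presented_group_def)
  show "\<one>\<^bsub>?G\<^esub> \<in> carrier ?G" by (auto simp: carr one)
  show "x \<otimes>\<^bsub>?G\<^esub> y \<in> carrier ?G" if "x \<in> carrier ?G" "y \<in> carrier ?G" for x y
    using that by (auto simp: carr pres_mult_class)
  show "x \<otimes>\<^bsub>?G\<^esub> y \<otimes>\<^bsub>?G\<^esub> z = x \<otimes>\<^bsub>?G\<^esub> (y \<otimes>\<^bsub>?G\<^esub> z)"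
    if "x \<in> carrier ?G" "y \<in> carrier ?G" "z \<in> carrier ?G" for x y z
    using that by (auto simp: carr pres_mult_class)
  show "\<one>\<^bsub>?G\<^esub> \<otimes>\<^bsub>?G\<^esub> x = x" if "x \<in> carrier ?G" for x
    using that by (auto simp: carr one pres_mult_class)
  show "\<exists>y\<in>carrier ?G. y \<otimes>\<^bsub>?G\<^esub> x = \<one>\<^bsub>?G\<^esub>" if x: "x \<in> carrier ?G" for x
  proof -
    obtain w where w: "w \<in> gwords S" "x = ?c w" using x by (auto simp: carr)
    have "?c (inv_word w @ w) = ?c []"
      using pres_eq_inv_word[OF w(1), of R]
      by (intro equiv_class_eq[OF equiv_pres_rel]) (auto simp: pres_rel_def)
    then show ?thesis using w
      by (intro bexI[of _ "?c (inv_word w)"]) (auto simp: carr one pres_mult_class)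
  qed
qed

locale dyer_graph =
  fixes V :: "'v set" and E :: "'v set set" and f :: "'v \<Rightarrow> enat" and m :: "'v set \<Rightarrow> nat"
  assumes finite_vertices: "finite V"
    and edges: "\<And>e. e \<in> E \<Longrightarrow> e \<subseteq> V \<and> card e = 2"
    and vertex_label: "\<And>v. v \<in> V \<Longrightarrow> 2 \<le> f v"
    and edge_label: "\<And>e. e \<in> E \<Longrightarrow> 2 \<le> m e"
    and label_compatible: "\<And>e v. e \<in> E \<Longrightarrow> v \<in> e \<Longrightarrow> 3 \<le> f v \<Longrightarrow> m e = 2"

fun alternating :: "'v \<Rightarrow> 'v \<Rightarrow> nat \<Rightarrow> 'v gword" where
  "alternating u v 0 = []"
| "alternating u v (Suc n) = (u, True) # alternating v u n"

definition dyer_relations ::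
  "'v set \<Rightarrow> 'v set set \<Rightarrow> ('v \<Rightarrow> enat) \<Rightarrow> ('v set \<Rightarrow> nat) \<Rightarrow> ('v gword \<times> 'v gword) set" where
  "dyer_relations V E f m =
     {(replicate n (v, True), []) | v n. v \<in> V \<and> f v = enat n} \<union>
     {(alternating u v (m {u, v}), alternating v u (m {u, v})) | u v. {u, v} \<in> E}"

definition dyer_group ::
  "'v set \<Rightarrow> 'v set set \<Rightarrow> ('v \<Rightarrow> enat) \<Rightarrow> ('v set \<Rightarrow> nat) \<Rightarrow> 'v gword set monoid" where
  "dyer_group V E f m = presented_group V (dyer_relations V E f m)"

definition induced_edges :: "'v set set \<Rightarrow> 'v set \<Rightarrow> 'v set set" where
  "induced_edges E A = {e \<in> E. e \<subseteq> A}"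

definition cross_edges :: "'v set \<Rightarrow> 'v set \<Rightarrow> 'v set set" where
  "cross_edges A B = {{a, b} | a b. a \<in> A \<and> b \<in> B}"

definition dyer_reducible :: "'v set \<Rightarrow> 'v set set \<Rightarrow> ('v set \<Rightarrow> nat) \<Rightarrow> bool" where
  "dyer_reducible V E m \<longleftrightarrow>
     (\<exists>A B. A \<noteq> {} \<and> B \<noteq> {} \<and> A \<inter> B = {} \<and> V = A \<union> B \<and>
        E = induced_edges E A \<union> induced_edges E B \<union> cross_edges A B \<and>
        (\<forall>e \<in> cross_edges A B. m e = 2))"

definition dyer_irreducible :: "'v set \<Rightarrow> 'v set set \<Rightarrow> ('v set \<Rightarrow> nat) \<Rightarrow> bool" where
  "dyer_irreducible V E m \<longleftrightarrow> \<not> dyer_reducible V E m"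

definition group_centre :: "('a, 'b) monoid_scheme \<Rightarrow> 'a set" where
  "group_centre G = {z \<in> carrier G. \<forall>g \<in> carrier G. z \<otimes>\<^bsub>G\<^esub> g = g \<otimes>\<^bsub>G\<^esub> z}"

end

theory Submission
  imports Complex_Main Defs
begin

text \<open>Why the theorem holds. Call a vertex big if its label is at least \<open>3\<close> (or infinite); all
  edges at a big vertex have label \<open>2\<close>. Suppose that there is more than one vertex, and let \<open>z\<close> be
  central in the Dyer group \<open>D\<close>.

  A central element avoids every big vertex \<open>v\<close>. Let \<open>H\<close> be the subgroup generated by the other
  vertices. As \<open>v\<close> is related to its neighbours only by commutation, \<open>D\<close> acts on the reduced words
  of the free product of copies of \<open>\<langle>v\<rangle>\<close>, one for each conjugate \<open>h v h\<inverse>\<close> with \<open>h\<close> in \<open>H\<close>: the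
  generator \<open>v\<close> multiplies from the left and \<open>H\<close> permutes the copies. The word obtained by applying
  \<open>z\<close> to the empty word is fixed by \<open>H\<close>, because the empty word is and \<open>z\<close> is central. If it were
  nonempty, its first syllable would name a conjugate of \<open>v\<close> fixed by \<open>H\<close>, and \<open>v\<close> would be
  central. Irreducibility excludes this, as it provides a vertex that is not adjacent to \<open>v\<close> and
  hence does not commute with it. So the word is empty, which means that \<open>z\<close> lies in \<open>H\<close>, and
  deleting \<open>v\<close> from a word for \<open>z\<close> does not change \<open>z\<close>
  (\<open>central_avoids_big_vertex\<close>).

  What remains is a word in the vertices of label \<open>2\<close>. Let \<open>C\<close> be the Coxeter group on the same
  graph with all vertex labels replaced by \<open>2\<close>. The word still commutes in \<open>C\<close> with every vertex:
  with those of label \<open>2\<close> because deleting the big vertices is a homomorphism from \<open>D\<close> to \<open>C\<close>, and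
  with a big vertex by the action above, now with copies indexed by \<open>C\<close>
  (\<open>commuting_in_coxeter_group\<close>). So it represents a central element of \<open>C\<close> inside the
  subgroup generated by a proper subset of the vertices.

  In an irreducible Coxeter group such an element is trivial
  (\<open>central_in_proper_parabolic_trivial\<close>). In a shortest word \<open>t\<^sub>1 \<dots> t\<^sub>k\<close> for it, with
  letters forming a set \<open>T\<close>, compare the reflections crossed by \<open>s t\<^sub>1 \<dots> t\<^sub>k\<close> and by
  \<open>t\<^sub>1 \<dots> t\<^sub>k s\<close> for a vertex \<open>s\<close> outside \<open>T\<close>. Their parities agree, so \<open>s t\<^sub>1 s\<close> lies in the subgroup
  generated by \<open>T\<close>. The reflection representation shows that this happens only if \<open>s\<close> and
  \<open>t\<^sub>1\<close> are joined by an edge of label \<open>2\<close>. Cancelling \<open>t\<^sub>1\<close> and repeating, all of \<open>T\<close> is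
  joined to its complement by edges of label \<open>2\<close>, and irreducibility forces \<open>T\<close> to be
  empty. Finally, deleting the big vertices is also a homomorphism from \<open>C\<close> to \<open>D\<close>, so the
  word is trivial in \<open>D\<close>.\<close>

section \<open>Words acting on sets and on presented groups\<close>

text \<open>The universal property of a presented group in the form of an action: words are told apart by
  letting them act on a set. The leftmost letter acts last, so that concatenation
  is composition.\<close>

lemma pres_eq_foldr:
  assumes "pres_eq S R u w"
    and closed: "\<And>s b y. s \<in> S \<Longrightarrow> y \<in> Y \<Longrightarrow> act (s, b) y \<in> Y"
    and inverse: "\<And>s b y. s \<in> S \<Longrightarrow> y \<in> Y \<Longrightarrow> act (s, b) (act (s, \<not> b) y) = y"
    and relation: "\<And>r r' y. (r, r') \<in> R \<Longrightarrow> r \<in> gwords S \<Longrightarrow> r' \<in> gwords S \<Longrightarrow> y \<in> Y \<Longrightarrow>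
      foldr act r y = foldr act r' y"
    and "y \<in> Y"
  shows "foldr act u y = foldr act w y"
proof -
  have foldr_closed: "foldr act x y \<in> Y" if "x \<in> gwords S" "y \<in> Y" for x y
    using that by (induction x) (auto intro: closed)
  show ?thesis
    using assms(1) \<open>y \<in> Y\<close>
  proof (induction arbitrary: y)
    case (cancel u w s b)
    then show ?case using inverse[of s "foldr act w y" b] foldr_closed by simp
  next
    case (relation u w r r')
    then show ?case using assms(4)[of r r' "foldr act w y"] foldr_closed by simp
  qed auto
qed

definition cls :: "'a set \<Rightarrow> ('a gword \<times> 'a gword) set \<Rightarrow> 'a gword \<Rightarrow> 'a gword set" where
  "cls S R w = pres_rel S R `` {w}"

locale presentation =
  fixes S :: "'a set" and R :: "('a gword \<times> 'a gword) set" and G :: "'a gword set monoid" (structure)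
  assumes G_def: "G = presented_group S R"

sublocale presentation \<subseteq> group G
  unfolding G_def by (rule group_presented_group)

context presentation
begin

abbreviation c :: "'a gword \<Rightarrow> 'a gword set" where "c \<equiv> cls S R"

lemma carrier_eq: "carrier G = c ` gwords S"
  by (auto simp: G_def presented_group_def quotient_def cls_def)

lemma c_closed [simp]: "w \<in> gwords S \<Longrightarrow> c w \<in> carrier G"
  by (simp add: carrier_eq)

lemma c_Nil: "c [] = \<one>"
  by (simp add: G_def presented_group_def cls_def)

lemma c_append: "u \<in> gwords S \<Longrightarrow> w \<in> gwords S \<Longrightarrow> c (u @ w) = c u \<otimes> c w"
  by (simp add: G_def pres_mult_class cls_def)

lemma c_Cons: "fst l \<in> S \<Longrightarrow> w \<in> gwords S \<Longrightarrow> c (l # w) = c [l] \<otimes> c w"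
  using c_append[of "[l]" w] by simp

lemma c_eq_iff: "u \<in> gwords S \<Longrightarrow> w \<in> gwords S \<Longrightarrow> c u = c w \<longleftrightarrow> pres_eq S R u w"
  unfolding cls_def using eq_equiv_class_iff[OF equiv_pres_rel, of u S w R]
  by (simp add: pres_rel_def)

lemma c_eqI: "pres_eq S R u w \<Longrightarrow> c u = c w"
  using c_eq_iff pres_eq_gwords by blast

lemma c_relation: "(r, r') \<in> R \<Longrightarrow> r \<in> gwords S \<Longrightarrow> r' \<in> gwords S \<Longrightarrow> c r = c r'"
  using c_eqI[OF pres_eq.relation[of "[]" S "[]" r r']] by simp

lemma c_cancel: "s \<in> S \<Longrightarrow> c [(s, b)] \<otimes> c [(s, \<not> b)] = \<one>"
  using c_eqI[OF pres_eq.cancel[of "[]" S "[]" s R b]] c_append[of "[(s, b)]" "[(s, \<not> b)]"]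
  by (simp add: c_Nil)

lemma c_False: "s \<in> S \<Longrightarrow> c [(s, False)] = inv (c [(s, True)])"
  using c_cancel[of s False] by (intro inv_equality[symmetric]) auto

lemma cancel_inv:
  assumes "x \<in> carrier G" "y \<in> carrier G"
  shows "inv x \<otimes> (x \<otimes> y) = y" "x \<otimes> (inv x \<otimes> y) = y"
  using assms by (simp_all add: m_assoc[symmetric])

lemma commute_iff_conj:
  "x \<in> carrier G \<Longrightarrow> y \<in> carrier G \<Longrightarrow> x \<otimes> y \<otimes> inv x = y \<longleftrightarrow> x \<otimes> y = y \<otimes> x"
  by (rule inv_solve_right') auto

lemma c_conj_foldr:
  assumes "w \<in> gwords S" "x \<in> carrier G"
  shows "foldr (\<lambda>l x. c [l] \<otimes> x \<otimes> inv (c [l])) w x = c w \<otimes> x \<otimes> inv (c w)"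
  using assms(1)
proof (induction w)
  case (Cons l w)
  then show ?case using assms(2)
    by (simp add: c_Cons[of l w] m_assoc inv_mult_group)
qed (use assms in \<open>simp add: c_Nil\<close>)

lemma c_conj_cancel:
  assumes "s \<in> S" "x \<in> carrier G"
  shows "c [(s, b)] \<otimes> (c [(s, \<not> b)] \<otimes> x \<otimes> inv (c [(s, \<not> b)])) \<otimes> inv (c [(s, b)]) = x"
proof -
  have "c [(s, b), (s, \<not> b)] = \<one>"
    using c_eqI[OF pres_eq.cancel[of "[]" S "[]" s R b]] assms(1) by (simp add: c_Nil)
  then show ?thesis using c_conj_foldr[of "[(s, b), (s, \<not> b)]" x] assms by simp
qed

lemma c_inv_word:
  assumes "w \<in> gwords S" shows "c (inv_word w) = inv (c w)"
  using c_eqI[OF pres_eq_inv_word[OF assms]] assms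
  by (intro inv_equality[symmetric]) (simp_all add: c_append c_Nil)

lemma conj_int_pow:
  assumes "a \<in> carrier G" "x \<in> carrier G"
  shows "(a \<otimes> x \<otimes> inv a) [^] (e::int) = a \<otimes> x [^] e \<otimes> inv a"
proof -
  interpret group_hom G G "\<lambda>x. a \<otimes> x \<otimes> inv a"
    by unfold_locales (use assms in \<open>auto simp: hom_def m_assoc inv_solve_left\<close>)
  show ?thesis using hom_int_pow[OF assms(2)] by simp
qed

end

section \<open>Dyer graphs\<close>

lemma alternating_gwords: "a \<in> S \<Longrightarrow> b \<in> S \<Longrightarrow> alternating a b n \<in> gwords S"
  by (induction n arbitrary: a b) auto

lemma replicate_gwords: "a \<in> S \<Longrightarrow> replicate n (a, b) \<in> gwords S"
  by (induction n) auto

lemma alternating_2: "alternating a b 2 = [(a, True), (b, True)]"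
  by (simp add: numeral_2_eq_2)

definition restrict_word :: "'a set \<Rightarrow> 'a gword \<Rightarrow> 'a gword" where
  "restrict_word P w = filter (\<lambda>l. fst l \<in> P) w"

lemma restrict_word_simps [simp]:
  "restrict_word P [] = []"
  "restrict_word P (l # w) = (if fst l \<in> P then l # restrict_word P w else restrict_word P w)"
  "restrict_word P (u @ w) = restrict_word P u @ restrict_word P w"
  by (auto simp: restrict_word_def)

lemma restrict_word_gwords: "w \<in> gwords S \<Longrightarrow> restrict_word P w \<in> gwords (S \<inter> P)"
  by (induction w) auto

lemma restrict_word_closed [simp]: "w \<in> gwords S \<Longrightarrow> restrict_word P w \<in> gwords S"
  by (induction w) auto

lemma restrict_word_id: "w \<in> gwords P \<Longrightarrow> restrict_word P w = w"
  by (induction w) auto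

lemma restrict_alternating:
  "a \<in> P \<Longrightarrow> b \<in> P \<Longrightarrow> restrict_word P (alternating a b n) = alternating a b n"
  by (induction n arbitrary: a b) auto

lemma restrict_replicate:
  "restrict_word P (replicate n (a, b)) = (if a \<in> P then replicate n (a, b) else [])"
  by (induction n) auto

lemma gwords_mono: "A \<subseteq> B \<Longrightarrow> w \<in> gwords A \<Longrightarrow> w \<in> gwords B"
  by (induction w) auto

lemma dyer_relationE:
  assumes "(r, r') \<in> dyer_relations V E f m"
  obtains (power) s n where "s \<in> V" "f s = enat n" "r = replicate n (s, True)" "r' = []"
  | (braid) a b where "{a, b} \<in> E" "r = alternating a b (m {a, b})" "r' = alternating b a (m {a, b})"
  using assms unfolding dyer_relations_def by blast

text \<open>An edge of label \<open>2\<close> is a commutation relation and survives when one of its ends is sent to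
  the identity, unlike a longer braid relation. Since a deleted vertex can have any order in the
  target, \<open>f'\<close> may differ from \<open>f\<close> outside \<open>P\<close>; this gives homomorphisms in both directions between
  a Dyer group and a Coxeter group on the same graph.\<close>

lemma dyer_relation_restrict:
  assumes "(r, r') \<in> dyer_relations V E f m" "r \<in> gwords V" "r' \<in> gwords V"
    and f': "\<And>s. s \<in> V \<inter> P \<Longrightarrow> f' s = f s"
    and m: "\<And>e. e \<in> E \<Longrightarrow> \<not> e \<subseteq> P \<Longrightarrow> m e = 2"
  shows "pres_eq V (dyer_relations V E f' m) (restrict_word P r) (restrict_word P r')"
proof -
  have rel: ?thesis if "(r, r') \<in> dyer_relations V E f' m" "restrict_word P r = r" "restrict_word P r' = r'"
    using pres_eq.relation[of "[]" V "[]", OF _ _ that(1)] assms(2,3) that by simp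
  show ?thesis using assms(1)
  proof (cases rule: dyer_relationE)
    case (power s n)
    then have "s \<in> P \<Longrightarrow> (r, r') \<in> dyer_relations V E f' m" using f'[of s]
      by (auto simp: dyer_relations_def)
    then show ?thesis using rel power by (auto simp: restrict_replicate intro: pres_eq.refl)
  next
    case (braid a b)
    show ?thesis
    proof (cases "{a, b} \<subseteq> P")
      case True
      then show ?thesis using braid
        by (intro rel) (auto simp: restrict_alternating dyer_relations_def)
    next
      case False
      then have "m {a, b} = 2" using m braid by blast
      then show ?thesis using braid False assms(2,3)
        by (auto simp: alternating_2 intro!: pres_eq.refl)
    qed
  qed
qed

lemma pres_eq_restrict:
  assumes "pres_eq V (dyer_relations V E f m) u w"
    and "\<And>s. s \<in> V \<inter> P \<Longrightarrow> f' s = f s"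
    and "\<And>e. e \<in> E \<Longrightarrow> \<not> e \<subseteq> P \<Longrightarrow> m e = 2"
  shows "pres_eq V (dyer_relations V E f' m) (restrict_word P u) (restrict_word P w)"
  using assms(1)
proof (induction)
  case (refl w)
  then show ?case by (simp add: pres_eq.refl)
next
  case (cancel u w s b)
  then show ?case
    using pres_eq.cancel[of "restrict_word P u" V "restrict_word P w" s "dyer_relations V E f' m" b]
    by (cases "s \<in> P") (auto intro: pres_eq.refl)
next
  case (relation u w r r')
  then show ?case
    using pres_eq_context[OF dyer_relation_restrict[OF relation(3-5), of P f'],
        of "restrict_word P u" "restrict_word P w"] assms(2,3) by simp
qed (blast intro: pres_eq.sym pres_eq.trans)+

context dyer_graph
begin

lemma edgeD:
  assumes "{a, b} \<in> E"
  shows "a \<in> V" "b \<in> V" "a \<noteq> b"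
  using edges[OF assms] by auto

lemma label_cases: "v \<in> V \<Longrightarrow> f v = 2 \<or> 3 \<le> f v"
  using vertex_label[of v] by (cases "f v") (auto simp: numeral_eq_enat)

lemma edge_2_commute:
  assumes "{a, b} \<in> E" "m {a, b} = 2"
  shows "pres_eq V (dyer_relations V E f' m) [(a, True), (b, True)] [(b, True), (a, True)]"
proof -
  have "(alternating a b 2, alternating b a 2) \<in> dyer_relations V E f' m"
    using assms unfolding dyer_relations_def by (intro UnI2) force
  then show ?thesis using pres_eq.relation[of "[]" V "[]"] edgeD[OF assms(1)]
    by (force simp: alternating_2)
qed

lemma edge_label_outside:
  assumes "e \<in> E" "\<not> e \<subseteq> {s \<in> V. f s = 2}"
  shows "m e = 2"
  using assms edges[of e] label_cases label_compatible[of e] by blast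

lemma joined_imp_reducible:
  assumes "T \<subseteq> V" "T \<noteq> {}" "T \<noteq> V"
    and joined: "\<And>t s. t \<in> T \<Longrightarrow> s \<in> V - T \<Longrightarrow> {s, t} \<in> E \<and> m {s, t} = 2"
  shows "dyer_reducible V E m"
  unfolding dyer_reducible_def
proof (intro exI conjI)
  show "E = induced_edges E T \<union> induced_edges E (V - T) \<union> cross_edges T (V - T)" (is "_ = ?R")
  proof
    show "E \<subseteq> ?R"
    proof
      fix e assume e: "e \<in> E"
      then obtain a b where ab: "e = {a, b}" using edges[of e] by (auto simp: card_2_iff)
      then have "a \<in> V" "b \<in> V" using e edgeD by blast+
      then show "e \<in> ?R" using e ab unfolding induced_edges_def cross_edges_def
        by (cases "a \<in> T"; cases "b \<in> T") blast+
    qed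
    show "?R \<subseteq> E" using joined by (auto simp: induced_edges_def cross_edges_def insert_commute)
  qed
  show "\<forall>e\<in>cross_edges T (V - T). m e = 2"
    using joined by (auto simp: cross_edges_def insert_commute)
qed (use assms in auto)

end

section \<open>Splitting off a vertex of order at least three\<close>

text \<open>A big vertex \<open>v\<close> and a set \<open>X\<close> on which the Dyer group of the remaining vertices acts by \<open>h\<close>,
  with a base point fixed by the neighbours of \<open>v\<close>. Such data extend to an action of the whole Dyer
  group on the free product of copies of \<open>\<langle>v\<rangle>\<close> indexed by \<open>X\<close>. Three choices of \<open>X\<close> are used below:
  a cyclic group, a Coxeter group under conjugation, and the conjugates of \<open>v\<close>.\<close>

locale vertex_action = dyer_graph V E f m
  for V :: "'v set" and E f m +
  fixes v :: 'v and X :: "'x set" and h :: "'v \<times> bool \<Rightarrow> 'x \<Rightarrow> 'x" and x0 :: 'x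
  assumes v: "v \<in> V" "3 \<le> f v"
    and x0: "x0 \<in> X"
    and h_closed: "\<And>s b x. s \<in> V - {v} \<Longrightarrow> x \<in> X \<Longrightarrow> h (s, b) x \<in> X"
    and h_inverse: "\<And>s b x. s \<in> V - {v} \<Longrightarrow> x \<in> X \<Longrightarrow> h (s, b) (h (s, \<not> b) x) = x"
    and h_relation: "\<And>r r' x. (r, r') \<in> dyer_relations V E f m \<Longrightarrow> r \<in> gwords (V - {v}) \<Longrightarrow>
      r' \<in> gwords (V - {v}) \<Longrightarrow> x \<in> X \<Longrightarrow> foldr h r x = foldr h r' x"
    and h_x0: "\<And>s. {s, v} \<in> E \<Longrightarrow> h (s, True) x0 = x0"
begin

text \<open>The order of \<open>v\<close>, with \<open>0\<close> for infinite order: since \<open>e mod 0 = e\<close>, reduction modulo \<open>N\<close> gives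
  the normal form of an exponent of \<open>v\<close> in both cases.\<close>

definition N :: int where
  "N = (case f v of enat n \<Rightarrow> int n | \<infinity> \<Rightarrow> 0)"

text \<open>Reduced words of the free product: a syllable \<open>(x, e)\<close> is the power \<open>e\<close> in the copy
  indexed by \<open>x\<close>.\<close>

fun reduced :: "('x \<times> int) list \<Rightarrow> bool" where
  "reduced [] = True"
| "reduced ((x, e) # w) =
     (x \<in> X \<and> e mod N = e \<and> e \<noteq> 0 \<and> (w = [] \<or> fst (hd w) \<noteq> x) \<and> reduced w)"

text \<open>A reduced word is uniquely \<open>put e w\<close> with \<open>e\<close> normalised and \<open>w\<close> not beginning with a syllable
  at \<open>x0\<close>. In these coordinates left multiplication by \<open>v\<close> is addition to the exponent, which makes
  \<open>shift\<close> an action of the integers and saves the case analysis on cancellation.\<close>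

fun head_exp :: "('x \<times> int) list \<Rightarrow> int" where
  "head_exp [] = 0"
| "head_exp ((x, e) # w) = (if x = x0 then e else 0)"

fun rest :: "('x \<times> int) list \<Rightarrow> ('x \<times> int) list" where
  "rest [] = []"
| "rest ((x, e) # w) = (if x = x0 then w else (x, e) # w)"

definition put :: "int \<Rightarrow> ('x \<times> int) list \<Rightarrow> ('x \<times> int) list" where
  "put e w = (if e mod N = 0 then w else (x0, e mod N) # w)"

definition shift :: "int \<Rightarrow> ('x \<times> int) list \<Rightarrow> ('x \<times> int) list" where
  "shift d w = put (head_exp w + d) (rest w)"

definition permute :: "'v \<times> bool \<Rightarrow> ('x \<times> int) list \<Rightarrow> ('x \<times> int) list" where
  "permute l = map (\<lambda>(x, e). (h l x, e))"

definition act :: "'v \<times> bool \<Rightarrow> ('x \<times> int) list \<Rightarrow> ('x \<times> int) list" where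
  "act l = (if fst l = v then shift (if snd l then 1 else - 1) else permute l)"

lemma N_cases: "N = 0 \<or> 3 \<le> N"
  using v(2) by (cases "f v") (auto simp: N_def numeral_eq_enat)

lemma not_zero_mod: "1 mod N \<noteq> 0" "(- 1) mod N \<noteq> 0"
  using N_cases by (auto simp: zmod_zminus1_eq_if)

lemma rest_props:
  "reduced w \<Longrightarrow> reduced (rest w)"
  "reduced w \<Longrightarrow> rest w = [] \<or> fst (hd (rest w)) \<noteq> x0"
  "reduced w \<Longrightarrow> put (head_exp w) (rest w) = w"
  subgoal by (cases w rule: reduced.cases) auto
  subgoal by (cases w rule: reduced.cases) auto
  subgoal by (cases w rule: reduced.cases) (auto simp: put_def)
  done

lemma put_props:
  assumes "w = [] \<or> fst (hd w) \<noteq> x0"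
  shows "head_exp (put e w) = e mod N" "rest (put e w) = w"
    and "reduced w \<Longrightarrow> reduced (put e w)"
proof -
  from assms show "head_exp (put e w) = e mod N" "rest (put e w) = w"
    by (cases w rule: reduced.cases; force simp: put_def)+
  show "reduced (put e w)" if "reduced w"
    using that assms x0 by (simp add: put_def)
qed

lemma reduced_shift: "reduced w \<Longrightarrow> reduced (shift d w)"
  unfolding shift_def by (intro put_props rest_props)

lemma put_mod: "put (e mod N) w = put e w"
  by (simp add: put_def)

lemma shift_shift:
  assumes "reduced w" shows "shift d (shift d' w) = shift (d + d') w"
proof -
  have "shift d (shift d' w) = put ((head_exp w + d') mod N + d) (rest w)"
    using put_props[OF rest_props(2)[OF assms]] by (simp add: shift_def)
  also have "\<dots> = put (head_exp w + d' + d) (rest w)"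
    using put_mod mod_add_left_eq by metis
  finally show ?thesis by (simp add: shift_def ac_simps)
qed

lemma shift_0: "reduced w \<Longrightarrow> shift 0 w = w"
  by (simp add: shift_def rest_props)

lemma shift_N: "reduced w \<Longrightarrow> shift N w = w"
  using put_mod[of "head_exp w + N" "rest w"] put_mod[of "head_exp w" "rest w"]
  by (simp add: shift_def rest_props)

lemma h_inj: "s \<in> V - {v} \<Longrightarrow> x \<in> X \<Longrightarrow> y \<in> X \<Longrightarrow> h (s, b) x = h (s, b) y \<longleftrightarrow> x = y"
  using h_inverse[of s _ "\<not> b"] by (metis (full_types))

lemma reduced_permute: "s \<in> V - {v} \<Longrightarrow> reduced w \<Longrightarrow> reduced (permute (s, b) w)"
proof (induction w rule: reduced.induct)
  case (2 x e w)
  have "hd (map (\<lambda>(x, e). (h (s, b) x, e)) w) = (h (s, b) (fst (hd w)), snd (hd w))" if "w \<noteq> []"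
    using that by (cases w) auto
  moreover have "fst (hd w) \<in> X" if "w \<noteq> []" using that 2(3) by (cases w) auto
  ultimately show ?case using 2 h_closed h_inj
    by (auto simp: permute_def)
qed (simp add: permute_def)

lemma permute_inverse:
  "s \<in> V - {v} \<Longrightarrow> reduced w \<Longrightarrow> permute (s, b) (permute (s, \<not> b) w) = w"
  by (induction w rule: reduced.induct) (use h_inverse in \<open>auto simp: permute_def\<close>)

lemma reduced_act: "s \<in> V \<Longrightarrow> reduced w \<Longrightarrow> reduced (act (s, b) w)"
  by (simp add: act_def reduced_shift reduced_permute)

lemma foldr_act_reduced: "g \<in> gwords V \<Longrightarrow> reduced w \<Longrightarrow> reduced (foldr act g w)"
  by (induction g) (auto simp: reduced_act)

lemma act_inverse: "s \<in> V \<Longrightarrow> reduced w \<Longrightarrow> act (s, b) (act (s, \<not> b) w) = w"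
  by (auto simp: act_def shift_shift shift_0 permute_inverse)

lemma foldr_act_permute:
  "g \<in> gwords (V - {v}) \<Longrightarrow> foldr act g w = map (\<lambda>(x, e). (foldr h g x, e)) w"
  by (induction g) (auto simp: act_def permute_def)

lemma foldr_act_power: "reduced w \<Longrightarrow> foldr act (replicate n (v, True)) w = shift (int n) w"
  by (induction n) (simp_all add: act_def shift_0 shift_shift add.commute)

text \<open>The commutation relation of \<open>v\<close> with a neighbour; here it matters that the base point is
  fixed.\<close>

lemma shift_permute:
  assumes "{s, v} \<in> E" "reduced w"
  shows "permute (s, True) (shift d w) = shift d (permute (s, True) w)"
proof -
  have s: "s \<in> V - {v}" using edgeD[OF assms(1)] by blast
  have put: "permute (s, True) (put e u) = put e (permute (s, True) u)" for e u
    using h_x0[OF assms(1)] by (simp add: put_def permute_def)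
  have "head_exp (permute (s, True) w) = head_exp w" "rest (permute (s, True) w) = permute (s, True) (rest w)"
    using assms(2) h_inj[OF s, of _ x0 True] x0 h_x0[OF assms(1)]
    by (cases w; force simp: permute_def)+
  then show ?thesis by (simp add: shift_def put)
qed

lemma act_relation:
  assumes "(r, r') \<in> dyer_relations V E f m" "r \<in> gwords V" "r' \<in> gwords V" "reduced w"
  shows "foldr act r w = foldr act r' w"
proof -
  have X: "x \<in> X" if "(x, e) \<in> set w" for x e
    using that assms(4) by (induction w rule: reduced.induct) auto
  have off: ?thesis if "r \<in> gwords (V - {v})" "r' \<in> gwords (V - {v})"
    using that h_relation[OF assms(1)] X by (auto simp: foldr_act_permute)
  show ?thesis using assms(1)
  proof (cases rule: dyer_relationE)
    case (power s n)
    show ?thesis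
    proof (cases "s = v")
      case True
      then have "N = int n" using power by (simp add: N_def)
      then show ?thesis using power True assms(4) foldr_act_power[of w n] shift_N[of w] by simp
    next
      case False
      have "replicate n (s, True) \<in> gwords (V - {v})" using power False by (intro replicate_gwords) auto
      then show ?thesis using power off by simp
    qed
  next
    case (braid a b)
    have ab: "a \<in> V" "b \<in> V" "a \<noteq> b" using edgeD braid by auto
    show ?thesis
    proof (cases "v \<in> {a, b}")
      case True
      have "m {a, b} = 2" using label_compatible[OF braid(1) True v(2)] .
      then show ?thesis
        using braid True assms(4) ab shift_permute[of a w 1] shift_permute[of b w 1]
        by (auto simp: alternating_2 act_def insert_commute)
    next
      case False
      then show ?thesis using braid ab by (intro off) (auto intro: alternating_gwords)
    qed
  qed
qed

lemma pres_eq_act: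
  assumes "pres_eq V (dyer_relations V E f m) g g'" "reduced w"
  shows "foldr act g w = foldr act g' w"
  using assms(1) by (rule pres_eq_foldr[where Y = "Collect reduced"])
    (use assms(2) in \<open>auto simp: reduced_act act_inverse intro: act_relation\<close>)

text \<open>Applied to the empty word, the two sides give the single syllable \<open>v\<close> at \<open>g x0\<close> and at
  \<open>x0\<close> respectively.\<close>

lemma commuting_fixes_x0:
  assumes "g \<in> gwords (V - {v})"
    and "pres_eq V (dyer_relations V E f m) (g @ [(v, True)]) ((v, True) # g)"
  shows "foldr h g x0 = x0"
  using pres_eq_act[OF assms(2), of "[]"] not_zero_mod
  by (simp add: foldr_act_permute[OF assms(1)] act_def shift_def put_def)

end

text \<open>Let \<open>u\<close> translate its own cyclic group, with base point \<open>0\<close>, and let the other vertices act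
  trivially. As \<open>u\<close> is not adjacent to \<open>v\<close>, it may move the base point.\<close>

lemma (in dyer_graph) nonadjacent_big_not_commute:
  assumes uv: "u \<in> V" "v \<in> V" "u \<noteq> v" "{u, v} \<notin> E" "3 \<le> f u" "3 \<le> f v"
  shows "\<not> pres_eq V (dyer_relations V E f m) [(u, True), (v, True)] [(v, True), (u, True)]"
proof
  assume comm: "pres_eq V (dyer_relations V E f m) [(u, True), (v, True)] [(v, True), (u, True)]"
  define M where "M = (case f u of enat n \<Rightarrow> int n | \<infinity> \<Rightarrow> 0)"
  have M: "M = 0 \<or> 3 \<le> M" using uv(5) by (cases "f u") (auto simp: M_def numeral_eq_enat)
  define h :: "'v \<times> bool \<Rightarrow> int \<Rightarrow> int" where
    "h l j = (if fst l = u then (j + (if snd l then 1 else - 1)) mod M else j)" for l j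
  have other: "foldr h r j = j" if "r \<in> gwords (V - {u})" for r j
    using that by (induction r) (auto simp: h_def)
  have foldr_power: "foldr h (replicate n (u, True)) j = (if n = 0 then j else (j + int n) mod M)" for n j
    by (induction n) (auto simp: h_def mod_simps algebra_simps)
  interpret vertex_action V E f m v "{j. j mod M = j}" h 0
  proof
    show "h (s, b) (h (s, \<not> b) x) = x" if "x \<in> {j. j mod M = j}" for s b x
      using that by (auto simp: h_def mod_simps)
    show "foldr h r x = foldr h r' x"
      if "(r, r') \<in> dyer_relations V E f m" and r: "r \<in> gwords (V - {v})" "r' \<in> gwords (V - {v})"
        and x: "x \<in> {j. j mod M = j}" for r r' x
      using that(1)
    proof (cases rule: dyer_relationE)
      case (power s n)
      show ?thesis
      proof (cases "s = u")
        case True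
        then have "M = int n" using power by (simp add: M_def)
        then show ?thesis using power True x foldr_power[of n x] by auto
      next
        case False
        have "replicate n (s, True) \<in> gwords (V - {u})" using power False by (intro replicate_gwords) auto
        then show ?thesis using power other[of "replicate n (s, True)" x] by simp
      qed
    next
      case (braid a b)
      show ?thesis
      proof (cases "u \<in> {a, b}")
        case True
        have "m {a, b} = 2" using label_compatible[OF braid(1) True uv(5)] .
        then show ?thesis using braid by (auto simp: alternating_2 h_def)
      next
        case False
        then have "r \<in> gwords (V - {u})" "r' \<in> gwords (V - {u})"
          using braid edgeD[of a b] by (auto intro: alternating_gwords)
        then show ?thesis by (simp add: other)
      qed
    qed
  qed (use uv M in \<open>auto simp: h_def\<close>)
  have "1 mod M = 0"
    using commuting_fixes_x0[of "[(u, True)]"] comm uv by (simp add: h_def)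
  then show False using M by auto
qed

context dyer_graph
begin

abbreviation V2 :: "'v set" where "V2 \<equiv> {s \<in> V. f s = 2}"

abbreviation cox :: "('v gword \<times> 'v gword) set" where "cox \<equiv> dyer_relations V E (\<lambda>_. 2) m"

text \<open>The vertices of label \<open>2\<close> act on the Coxeter group by conjugation, the big ones trivially, and the
  base point is the generator \<open>v\<close> of the Coxeter group. A word in vertices of label \<open>2\<close> that commutes
  with \<open>v\<close> in the Dyer group fixes the base point, and this is commutation with \<open>v\<close> in the Coxeter group. No
  homomorphism sends \<open>v\<close> to that generator when the order of \<open>v\<close> is odd, hence the detour.\<close>

lemma commuting_in_coxeter_group:
  assumes v: "v \<in> V" "3 \<le> f v" and g: "g \<in> gwords V2"
    and comm: "pres_eq V (dyer_relations V E f m) (g @ [(v, True)]) ((v, True) # g)"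
  shows "pres_eq V cox (g @ [(v, True)]) ((v, True) # g)"
proof -
  define G where "G = presented_group V cox"
  interpret C: presentation V cox G by unfold_locales (simp add: G_def)
  define h where "h l x = (if fst l \<in> V2 then C.c [l] \<otimes>\<^bsub>G\<^esub> x \<otimes>\<^bsub>G\<^esub> inv\<^bsub>G\<^esub> (C.c [l]) else x)" for l x
  have restr: "restrict_word V2 r \<in> gwords V" if "r \<in> gwords V" for r
    using that by simp
  have foldr_h: "foldr h r x = C.c (restrict_word V2 r) \<otimes>\<^bsub>G\<^esub> x \<otimes>\<^bsub>G\<^esub> inv\<^bsub>G\<^esub> (C.c (restrict_word V2 r))"
    if "r \<in> gwords V" "x \<in> carrier G" for r x
  proof -
    have "foldr h r x = foldr (\<lambda>l x. C.c [l] \<otimes>\<^bsub>G\<^esub> x \<otimes>\<^bsub>G\<^esub> inv\<^bsub>G\<^esub> (C.c [l])) (restrict_word V2 r) x"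
      by (induction r) (auto simp: h_def)
    then show ?thesis using C.c_conj_foldr[OF restr] that by simp
  qed
 have "v \<notin> V2" using v(2) by (auto simp: numeral_eq_enat)
  then have gV: "g \<in> gwords V" "g \<in> gwords (V - {v})"
    using gwords_mono[OF _ g, of V] gwords_mono[OF _ g, of "V - {v}"] by blast+
  interpret vertex_action V E f m v "carrier G" h "C.c [(v, True)]"
  proof
    show "h (s, b) x \<in> carrier G" if "s \<in> V - {v}" "x \<in> carrier G" for s b x
      using that by (auto simp: h_def)
    show "h (s, b) (h (s, \<not> b) x) = x" if "s \<in> V - {v}" "x \<in> carrier G" for s b x
      using that C.c_conj_cancel by (auto simp: h_def)
    show "foldr h r x = foldr h r' x"
      if "(r, r') \<in> dyer_relations V E f m" "r \<in> gwords (V - {v})" "r' \<in> gwords (V - {v})"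
        "x \<in> carrier G" for r r' x
    proof -
      have r: "r \<in> gwords V" "r' \<in> gwords V"
        using that(2,3) gwords_mono[of "V - {v}" V] by auto
      have "pres_eq V cox (restrict_word V2 r) (restrict_word V2 r')"
        using dyer_relation_restrict[OF that(1) r, of V2] edge_label_outside by auto
      note C.c_eqI[OF this]
      then show ?thesis by (simp only: foldr_h[OF r(1) that(4)] foldr_h[OF r(2) that(4)])
    qed
    show "h (s, True) (C.c [(v, True)]) = C.c [(v, True)]" if sv: "{s, v} \<in> E" for s
    proof -
      have "m {s, v} = 2" using label_compatible[OF sv, of v] v by simp
      note C.c_eqI[OF edge_2_commute[OF sv this]]
      then have "C.c [(s, True)] \<otimes>\<^bsub>G\<^esub> C.c [(v, True)] = C.c [(v, True)] \<otimes>\<^bsub>G\<^esub> C.c [(s, True)]"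
        using edgeD[OF sv]
        by (simp add: C.c_append[of "[(s, True)]" "[(v, True)]", simplified]
          C.c_append[of "[(v, True)]" "[(s, True)]", simplified])
      then show ?thesis using C.commute_iff_conj[of "C.c [(s, True)]" "C.c [(v, True)]"] edgeD[OF sv]
        by (simp only: h_def C.c_closed gwords_Cons gwords_Nil fst_conv simp_thms split: if_split)
    qed
  qed (use v in auto)
  have "C.c g \<otimes>\<^bsub>G\<^esub> C.c [(v, True)] = C.c [(v, True)] \<otimes>\<^bsub>G\<^esub> C.c g"
    using commuting_fixes_x0[OF gV(2) comm] foldr_h[OF gV(1)] gV v restrict_word_id[OF g]
    by (simp add: C.commute_iff_conj)
  then show ?thesis using gV v
    by (simp add: C.c_eq_iff[symmetric] C.c_append C.c_Cons[of _ g])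
qed

text \<open>With the conjugates of \<open>v\<close> as index set, a reduced word can be evaluated in the Dyer group
  itself. By \<open>normal_form\<close> every element is the value of the reduced word it makes out of the
  empty word, times an element in which \<open>v\<close> has been deleted. For a central element that reduced
  word is fixed by all vertices other than \<open>v\<close>, which act transitively on the index set; so it
  is empty, unless \<open>v\<close> commutes with all other vertices.\<close>

lemma central_avoids_big_vertex:
  assumes v: "v \<in> V" "3 \<le> f v" and w: "w \<in> gwords V"
    and central: "\<And>g. g \<in> gwords V \<Longrightarrow> pres_eq V (dyer_relations V E f m) (w @ g) (g @ w)"
    and u: "u \<in> V" "u \<noteq> v"
      "\<not> pres_eq V (dyer_relations V E f m) [(u, True), (v, True)] [(v, True), (u, True)]"
  shows "pres_eq V (dyer_relations V E f m) w (restrict_word (V - {v}) w)"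
proof -
  define G where "G = presented_group V (dyer_relations V E f m)"
  interpret D: presentation V "dyer_relations V E f m" G by unfold_locales (simp add: G_def)
  define h where "h l x = D.c [l] \<otimes>\<^bsub>G\<^esub> x \<otimes>\<^bsub>G\<^esub> inv\<^bsub>G\<^esub> (D.c [l])" for l x
  define x0 where "x0 = D.c [(v, True)]"
  define X where "X = (\<lambda>g. foldr h g x0) ` gwords (V - {v})"
  have sub: "g \<in> gwords V" if "g \<in> gwords (V - {v})" for g
    using that gwords_mono[of "V - {v}" V] by auto
  have x0_carrier: "x0 \<in> carrier G" using v by (simp add: x0_def)
  have foldr_h: "foldr h g x = D.c g \<otimes>\<^bsub>G\<^esub> x \<otimes>\<^bsub>G\<^esub> inv\<^bsub>G\<^esub> (D.c g)"
    if "g \<in> gwords V" "x \<in> carrier G" for g x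
    using D.c_conj_foldr[OF that] by (simp add: h_def[abs_def])
  have X_carrier: "x \<in> carrier G" if "x \<in> X" for x
    using that by (auto simp: X_def foldr_h sub x0_carrier)
  interpret vertex_action V E f m v X h x0
  proof
    show "x0 \<in> X" unfolding X_def by (intro image_eqI[of _ _ "[]"]) auto
    show "h (s, b) x \<in> X" if s: "s \<in> V - {v}" and x: "x \<in> X" for s b x
    proof -
      obtain g where "g \<in> gwords (V - {v})" "x = foldr h g x0"
        using x unfolding X_def by blast
      then show ?thesis using s unfolding X_def
        by (intro image_eqI[of _ _ "(s, b) # g"]) auto
    qed
    show "h (s, b) (h (s, \<not> b) x) = x" if "s \<in> V - {v}" "x \<in> X" for s b x
      using that X_carrier D.c_conj_cancel by (auto simp: h_def)
    show "foldr h r x = foldr h r' x"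
      if r: "(r, r') \<in> dyer_relations V E f m" "r \<in> gwords (V - {v})" "r' \<in> gwords (V - {v})"
        and x: "x \<in> X" for r r' x
    proof -
      have "D.c r = D.c r'"
        using D.c_relation r sub by simp
      then show ?thesis using foldr_h r sub x X_carrier by simp
    qed
    show "h (s, True) x0 = x0" if sv: "{s, v} \<in> E" for s
    proof -
      have "m {s, v} = 2" using label_compatible[OF sv, of v] v by simp
      note D.c_eqI[OF edge_2_commute[OF sv this]]
      then have "D.c [(s, True)] \<otimes>\<^bsub>G\<^esub> D.c [(v, True)] = D.c [(v, True)] \<otimes>\<^bsub>G\<^esub> D.c [(s, True)]"
        using edgeD[OF sv]
        by (simp add: D.c_append[of "[(s, True)]" "[(v, True)]", simplified]
          D.c_append[of "[(v, True)]" "[(s, True)]", simplified])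
      then show ?thesis using D.commute_iff_conj[of "D.c [(s, True)]" "D.c [(v, True)]"] edgeD[OF sv]
        by (simp only: h_def x0_def D.c_closed gwords_Cons gwords_Nil fst_conv simp_thms split: if_split)
    qed
  qed (use v in auto)

  define ev where "ev w = foldr (\<lambda>(x, e) y. x [^]\<^bsub>G\<^esub> e \<otimes>\<^bsub>G\<^esub> y) w \<one>\<^bsub>G\<^esub>" for w :: "('v gword set \<times> int) list"
  have ev_simps [simp]: "ev [] = \<one>\<^bsub>G\<^esub>" "ev ((x, e) # y) = x [^]\<^bsub>G\<^esub> e \<otimes>\<^bsub>G\<^esub> ev y" for x e y
    by (auto simp: ev_def)
  have ev_closed: "ev y \<in> carrier G" if "reduced y" for y
    using that by (induction y rule: reduced.induct) (auto intro: X_carrier)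
  have pow_N: "x0 [^]\<^bsub>G\<^esub> N = \<one>\<^bsub>G\<^esub>"
  proof (cases "f v")
    case (enat n)
    have "x0 [^]\<^bsub>G\<^esub> k = D.c (replicate k (v, True))" for k :: nat
    proof (induction k)
      case (Suc k)
      then show ?case using v replicate_gwords[of v V k True] D.c_append[of "replicate k (v, True)" "[(v, True)]"]
        by (simp add: x0_def replicate_append_same)
    qed (simp add: D.c_Nil)
    moreover have "D.c (replicate n (v, True)) = D.c []"
      using v enat replicate_gwords[of v V n True]
      by (intro D.c_relation) (auto simp: dyer_relations_def)
    ultimately show ?thesis using enat by (simp add: N_def int_pow_int D.c_Nil)
  qed (simp add: N_def)
  have pow_mod: "x0 [^]\<^bsub>G\<^esub> (e mod N) = x0 [^]\<^bsub>G\<^esub> e" for e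
  proof -
    have "x0 [^]\<^bsub>G\<^esub> e = x0 [^]\<^bsub>G\<^esub> (N * (e div N) + e mod N)" by simp
    also have "\<dots> = (x0 [^]\<^bsub>G\<^esub> N) [^]\<^bsub>G\<^esub> (e div N) \<otimes>\<^bsub>G\<^esub> x0 [^]\<^bsub>G\<^esub> (e mod N)"
      using x0_carrier by (simp only: D.int_pow_mult D.int_pow_pow)
    finally show ?thesis using pow_N x0_carrier by simp
  qed
  have ev_put: "ev (put e y) = x0 [^]\<^bsub>G\<^esub> e \<otimes>\<^bsub>G\<^esub> ev y" if "reduced y" for e y
    using pow_mod[of e, symmetric] ev_closed[OF that] by (simp add: put_def)
  have ev_shift: "ev (shift d y) = x0 [^]\<^bsub>G\<^esub> d \<otimes>\<^bsub>G\<^esub> ev y" if y: "reduced y" for d y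
  proof -
    have "ev (shift d y) = x0 [^]\<^bsub>G\<^esub> d \<otimes>\<^bsub>G\<^esub> (x0 [^]\<^bsub>G\<^esub> head_exp y \<otimes>\<^bsub>G\<^esub> ev (rest y))"
      using ev_put[OF rest_props(1)[OF y]] ev_closed[OF rest_props(1)[OF y]] x0_carrier
      by (simp add: shift_def D.int_pow_mult D.m_assoc[symmetric] add.commute[of _ d])
    also have "x0 [^]\<^bsub>G\<^esub> head_exp y \<otimes>\<^bsub>G\<^esub> ev (rest y) = ev y"
      using ev_put[OF rest_props(1)[OF y], of "head_exp y"] rest_props(3)[OF y] by simp
    finally show ?thesis .
  qed
  have ev_permute: "ev (permute l y) = D.c [l] \<otimes>\<^bsub>G\<^esub> ev y \<otimes>\<^bsub>G\<^esub> inv\<^bsub>G\<^esub> (D.c [l])"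
    if l: "fst l \<in> V" and "reduced y" for l y
    using that(2)
  proof (induction y rule: reduced.induct)
    case (2 x e y)
    let ?a = "D.c [l]"
    have carr: "x \<in> carrier G" "ev y \<in> carrier G" "?a \<in> carrier G" using 2 l X_carrier ev_closed by auto
    have "ev (permute l ((x, e) # y)) = h l x [^]\<^bsub>G\<^esub> e \<otimes>\<^bsub>G\<^esub> ev (permute l y)"
      by (simp add: permute_def)
    also have "\<dots> = ?a \<otimes>\<^bsub>G\<^esub> x [^]\<^bsub>G\<^esub> e \<otimes>\<^bsub>G\<^esub> inv\<^bsub>G\<^esub> ?a \<otimes>\<^bsub>G\<^esub> (?a \<otimes>\<^bsub>G\<^esub> ev y \<otimes>\<^bsub>G\<^esub> inv\<^bsub>G\<^esub> ?a)"
      using 2 carr by (simp add: h_def[of l x] D.conj_int_pow)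
    also have "\<dots> = ?a \<otimes>\<^bsub>G\<^esub> ev ((x, e) # y) \<otimes>\<^bsub>G\<^esub> inv\<^bsub>G\<^esub> ?a"
      using carr by (simp add: D.m_assoc D.cancel_inv)
    finally show ?case .
  qed (use l in \<open>simp add: permute_def\<close>)

  \<comment> \<open>\<open>act\<close> was modelled on left multiplication, so the claim follows letter by letter.\<close>
  have normal_form: "D.c g = ev (foldr act g []) \<otimes>\<^bsub>G\<^esub> D.c (restrict_word (V - {v}) g)"
    if "g \<in> gwords V" for g
    using that
  proof (induction g)
    case (Cons l g)
    let ?y = "foldr act g []" and ?r = "restrict_word (V - {v}) g"
    have l: "fst l \<in> V" and g: "g \<in> gwords V" using Cons.prems by auto
    have r: "?r \<in> gwords V" using g by simp
    have y: "reduced ?y" "ev ?y \<in> carrier G"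
      using foldr_act_reduced[OF g, of "[]"] ev_closed by auto
    have "D.c (l # g) = D.c [l] \<otimes>\<^bsub>G\<^esub> (ev ?y \<otimes>\<^bsub>G\<^esub> D.c ?r)"
      using Cons.IH[OF g] D.c_Cons[OF l g] by simp
    also have "\<dots> = ev (act l ?y) \<otimes>\<^bsub>G\<^esub> D.c (restrict_word (V - {v}) (l # g))"
    proof (cases "fst l = v")
      case True
      have "D.c [l] = x0 [^]\<^bsub>G\<^esub> (if snd l then 1 else - 1 :: int)"
        using True v D.c_False[of v] x0_carrier
        by (cases l) (auto simp: x0_def D.int_pow_neg)
      then show ?thesis using True y r x0_carrier l
        by (auto simp: act_def ev_shift D.m_assoc)
    next
      case False
      have "D.c (l # ?r) = D.c [l] \<otimes>\<^bsub>G\<^esub> D.c ?r" by (rule D.c_Cons[OF l r])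
      moreover have "D.c [l] \<in> carrier G" "D.c ?r \<in> carrier G" using l r by auto
      ultimately show ?thesis using False y l
        by (simp add: act_def ev_permute D.m_assoc D.cancel_inv)
    qed
    finally show ?case by simp
  qed (simp add: D.c_Nil)

  have "foldr act w [] = []"
  proof (cases "foldr act w []")
    case (Cons y ys)
    obtain x1 e1 where y: "y = (x1, e1)" by (cases y)
    have "x1 \<in> X" using foldr_act_reduced[OF w, of "[]"] Cons y by simp
    then obtain g1 where g1: "g1 \<in> gwords (V - {v})" "x1 = foldr h g1 x0" by (auto simp: X_def)
    have fixed: "foldr h g x1 = x1" if "g \<in> gwords (V - {v})" for g
    proof -
      have "foldr act g (foldr act w []) = foldr act w (foldr act g [])"
        using pres_eq_act[OF central[OF sub[OF that]], of "[]"] by simp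
      then show ?thesis using Cons y by (simp add: foldr_act_permute[OF that])
    qed
    \<comment> \<open>The first index is a fixed point in the orbit of \<open>x0\<close>, so it is \<open>x0\<close>.\<close>
    have "x1 = foldr h (inv_word g1) x1" using fixed g1 by simp
    also have "\<dots> = x0"
      using g1 sub[OF g1(1)] x0_carrier
      by (simp add: foldr_h D.c_inv_word D.m_assoc D.cancel_inv)
    finally have "foldr h [(u, True)] x0 = x0" using fixed[of "[(u, True)]"] u by simp
    then have "D.c [(u, True)] \<otimes>\<^bsub>G\<^esub> x0 = x0 \<otimes>\<^bsub>G\<^esub> D.c [(u, True)]"
      using u x0_carrier by (simp add: h_def D.commute_iff_conj)
    then have False using u v
      by (simp add: x0_def D.c_append[symmetric] D.c_eq_iff)
    then show ?thesis ..
  qed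
  then have "D.c w = D.c (restrict_word (V - {v}) w)"
    using normal_form[OF w] w by simp
  then show ?thesis
    using w by (simp add: D.c_eq_iff)
qed

end

section \<open>The dual reflection representation\<close>

context dyer_graph
begin

text \<open>Twice the usual bilinear form on the simple roots, whose value is
  \<open>- cos (pi / m)\<close> on an edge and \<open>-1\<close> on a pair that is not an edge. The representation is dualised:
  a function \<open>\<phi>\<close> on vertices lists the values of a linear form on the simple roots. A generator
  \<open>t\<close> then fixes \<open>\<phi>\<close> exactly when \<open>\<phi> t = 0\<close>.\<close>

definition bilinear :: "'v \<Rightarrow> 'v \<Rightarrow> real" where
  "bilinear s t = (if s = t then 2 else if {s, t} \<in> E then - 2 * cos (pi / m {s, t}) else - 2)"

definition dual_reflection :: "'v \<times> bool \<Rightarrow> ('v \<Rightarrow> real) \<Rightarrow> 'v \<Rightarrow> real" where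
  "dual_reflection l \<phi> = (\<lambda>x. \<phi> x - bilinear (fst l) x * \<phi> (fst l))"

lemma dual_reflection_involution: "dual_reflection (s, b) (dual_reflection (s, b') \<phi>) = \<phi>"
  by (simp add: dual_reflection_def bilinear_def)

text \<open>The braid relation is checked in two steps. An alternating word changes \<open>\<phi>\<close> by a combination of
  two rows of the form, and these are linearly independent already on \<open>u\<close> and \<open>v\<close>; so it suffices to
  compare the values at \<open>u\<close> and \<open>v\<close>.\<close>

lemma dual_reflection_alternating_span:
  "\<exists>x y. foldr dual_reflection (alternating u v n) \<phi> = (\<lambda>z. \<phi> z - x * bilinear u z - y * bilinear v z)"
proof (induction n arbitrary: u v)
  case 0
  show ?case by (intro exI[of _ 0]) simp
next
  case (Suc n)
  obtain x y where xy: "foldr dual_reflection (alternating v u n) \<phi> = (\<lambda>z. \<phi> z - x * bilinear v z - y * bilinear u z)"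
    using Suc.IH by blast
  show ?case
    by (rule exI[of _ "y + (\<phi> u - x * bilinear v u - y * bilinear u u)"], rule exI[of _ x])
      (simp add: xy dual_reflection_def[of "(u, True)"] fun_eq_iff algebra_simps)
qed

text \<open>The coordinates satisfy the recursion \<open>e\<^sub>n\<^sub>+\<^sub>1 = 2 cos \<theta> e\<^sub>n - e\<^sub>n\<^sub>-\<^sub>1\<close>, which is solved by sines.
  The parity distinguishes whether the innermost letter, which acts first, is \<open>u\<close> or \<open>v\<close>; the
  letter that would be added next is \<open>v\<close>.\<close>

lemma dual_reflection_alternating_coords:
  fixes n :: nat and \<phi> :: "'v \<Rightarrow> real" and \<theta> p q :: real
  assumes uv: "{u, v} \<in> E"
  defines "\<theta> \<equiv> pi / m {u, v}"
  defines "p \<equiv> (if even n then \<phi> v else \<phi> u)" and "q \<equiv> (if even n then \<phi> u else \<phi> v)"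
  defines "\<psi> \<equiv> foldr dual_reflection (alternating u v n) \<phi>"
  shows "\<psi> v * sin \<theta> = p * sin ((n + 1) * \<theta>) + q * sin (n * \<theta>)"
    and "\<psi> u * sin \<theta> = - (p * sin (n * \<theta>) + q * sin ((real n - 1) * \<theta>))"
proof -
  have "\<psi> v * sin \<theta> = p * sin ((n + 1) * \<theta>) + q * sin (n * \<theta>) \<and>
      \<psi> u * sin \<theta> = - (p * sin (n * \<theta>) + q * sin ((real n - 1) * \<theta>))"
    using uv unfolding \<theta>_def p_def q_def \<psi>_def
  proof (induction n arbitrary: u v)
    case (Suc n)
    define t where "t = pi / m {u, v}"
    define \<chi> where "\<chi> = foldr dual_reflection (alternating v u n) \<phi>"
    define a where "a = (if even n then \<phi> u else \<phi> v)"
    define b where "b = (if even n then \<phi> v else \<phi> u)"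
    have vu: "{v, u} = {u, v}" by blast
    have IH: "\<chi> u * sin t = a * sin ((n + 1) * t) + b * sin (n * t)"
      "\<chi> v * sin t = - (a * sin (n * t) + b * sin ((real n - 1) * t))"
      using Suc.IH[of v u] Suc.prems unfolding vu t_def \<chi>_def a_def b_def by auto
    have step: "foldr dual_reflection (alternating u v (Suc n)) \<phi> = dual_reflection (u, True) \<chi>"
      by (simp add: \<chi>_def)
    have "bilinear u v = - 2 * cos t" "bilinear u u = 2"
      using Suc.prems edgeD[OF Suc.prems] by (auto simp: bilinear_def t_def)
    then have refl: "dual_reflection (u, True) \<chi> u = - \<chi> u"
      "dual_reflection (u, True) \<chi> v = \<chi> v + 2 * cos t * \<chi> u"
      by (simp_all add: dual_reflection_def)
    have ab: "(if even (Suc n) then \<phi> v else \<phi> u) = a" "(if even (Suc n) then \<phi> u else \<phi> v) = b"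
      by (simp_all add: a_def b_def)
    have trig: "2 * cos t * sin x = sin (x + t) + sin (x - t)" for x
      by (simp add: sin_add sin_diff)
    have "(\<chi> v + 2 * cos t * \<chi> u) * sin t = \<chi> v * sin t + 2 * cos t * (\<chi> u * sin t)"
      by (simp add: algebra_simps)
    also have "\<dots> = - (a * sin (n * t) + b * sin ((real n - 1) * t))
        + (a * (2 * cos t * sin ((n + 1) * t)) + b * (2 * cos t * sin (n * t)))"
      unfolding IH by (simp add: algebra_simps)
    also have "\<dots> = a * sin ((n + 1) * t + t) + b * sin (n * t + t)"
      unfolding trig by (simp add: algebra_simps)
    also have "\<dots> = a * sin (real (Suc n + 1) * t) + b * sin (real (Suc n) * t)"
      by (simp add: algebra_simps)
    finally have "(\<chi> v + 2 * cos t * \<chi> u) * sin t =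
      a * sin (real (Suc n + 1) * t) + b * sin (real (Suc n) * t)" .
    moreover have "- \<chi> u * sin t = - (a * sin (real (Suc n) * t) + b * sin ((real (Suc n) - 1) * t))"
      using IH(1) by (simp add: add.commute)
    ultimately show ?case unfolding step refl ab t_def[symmetric] by blast
  qed simp
  then show "\<psi> v * sin \<theta> = p * sin ((n + 1) * \<theta>) + q * sin (n * \<theta>)"
    and "\<psi> u * sin \<theta> = - (p * sin (n * \<theta>) + q * sin ((real n - 1) * \<theta>))" by auto
qed

lemma dual_reflection_braid:
  assumes uv: "{u, v} \<in> E"
  shows "foldr dual_reflection (alternating u v (m {u, v})) \<phi> = foldr dual_reflection (alternating v u (m {u, v})) \<phi>"
proof -
  define k where "k = m {u, v}"
  define t where "t = pi / k"
  have k: "2 \<le> k" using edge_label[OF uv] by (simp add: k_def)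
  have vu: "{v, u} \<in> E" "m {v, u} = k" using uv by (simp_all add: k_def insert_commute)
  have kt: "k * t = pi" using k by (simp add: t_def)
  have "0 < t" "t < pi" using k by (simp_all add: t_def field_simps)
  then have sin_t: "sin t > 0" by (rule sin_gt_zero)
  \<comment> \<open>After \<open>k\<close> steps the angle is \<open>pi\<close>, and the coordinates are, up to sign, the initial ones.\<close>
  have trig: "sin (real (k + 1) * t) = - sin t" "sin ((real k - 1) * t) = sin t" "sin (real k * t) = 0"
    using kt by (simp_all add: algebra_simps)
  let ?\<psi> = "foldr dual_reflection (alternating u v k) \<phi>"
    and ?\<psi>' = "foldr dual_reflection (alternating v u k) \<phi>"
  have "?\<psi> u * sin t = ?\<psi>' u * sin t" "?\<psi> v * sin t = ?\<psi>' v * sin t"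
    using dual_reflection_alternating_coords[OF uv, where n = k and \<phi> = \<phi>]
      dual_reflection_alternating_coords[OF vu(1), where n = k and \<phi> = \<phi>]
    unfolding vu(2) k_def[symmetric] t_def[symmetric] trig by (auto split: if_splits)
  then have coords: "?\<psi> u = ?\<psi>' u" "?\<psi> v = ?\<psi>' v" using sin_t by simp_all
  obtain x y where xy: "?\<psi> = (\<lambda>z. \<phi> z - x * bilinear u z - y * bilinear v z)"
    using dual_reflection_alternating_span by blast
  obtain x' y' where xy': "?\<psi>' = (\<lambda>z. \<phi> z - x' * bilinear v z - y' * bilinear u z)"
    using dual_reflection_alternating_span by blast
  define d where "d = x - y'"
  define e where "e = y - x'"
  have form: "bilinear u u = 2" "bilinear v v = 2" "bilinear u v = - 2 * cos t" "bilinear v u = - 2 * cos t"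
    using uv vu edgeD[OF uv] by (auto simp: bilinear_def t_def k_def insert_commute)
  \<comment> \<open>The Gram matrix of \<open>u\<close> and \<open>v\<close> has determinant \<open>4 (sin t)\<^sup>2\<close>, which is not zero.\<close>
  have "2 * d = 2 * cos t * e" "2 * e = 2 * cos t * d"
    using coords unfolding xy xy' form d_def e_def by (simp_all add: algebra_simps)
  then have de: "d = cos t * e" "e = cos t * d" by simp_all
  have "(sin t)\<^sup>2 * d = (1 - (cos t)\<^sup>2) * d" by (simp add: sin_squared_eq)
  also have "\<dots> = d - cos t * (cos t * d)" by (simp add: algebra_simps power2_eq_square)
  also have "\<dots> = 0" by (simp only: de(2)[symmetric] de(1)[symmetric] diff_self)
  finally have d: "d = 0" using sin_t by simp
  have "e = 0" using de(2) unfolding d by simp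
  then have "x = y'" "y = x'" using d by (simp_all add: d_def e_def)
  then show ?thesis unfolding k_def[symmetric] xy xy' by (simp add: algebra_simps)
qed

lemma pres_eq_dual_reflection:
  assumes "pres_eq V cox u w"
  shows "foldr dual_reflection u \<phi> = foldr dual_reflection w \<phi>"
proof (rule pres_eq_foldr[where Y = UNIV, OF assms])
  fix r r' \<phi> assume "(r, r') \<in> cox"
  then show "foldr dual_reflection r \<phi> = foldr dual_reflection r' \<phi>"
  proof (cases rule: dyer_relationE)
    case (power s n)
    then have "r = [(s, True), (s, True)]" by (auto simp: numeral_eq_enat numeral_2_eq_2)
    then show ?thesis using dual_reflection_involution power by simp
  qed (use dual_reflection_braid in auto)
qed (auto simp: dual_reflection_involution)

text \<open>The indicator function of \<open>s\<close> is fixed by \<open>T\<close>, hence by \<open>s t s\<close>. So its image under \<open>s\<close> is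
  fixed by \<open>t\<close> and vanishes at \<open>t\<close>; its value there is \<open>- bilinear s t\<close>. With \<open>T = {t}\<close> this
  also says that generators commute only if an edge of label \<open>2\<close> joins them.\<close>

lemma conjugate_in_parabolic_imp_joined:
  assumes "s \<notin> T" "s \<noteq> t" "q \<in> gwords T"
    and eq: "pres_eq V cox [(s, True), (t, True), (s, True)] q"
  shows "{s, t} \<in> E \<and> m {s, t} = 2"
proof -
  define \<delta> :: "'v \<Rightarrow> real" where "\<delta> x = (if x = s then 1 else 0)" for x
  have "foldr dual_reflection q \<delta> = \<delta>"
    using assms(3) by (induction q) (use assms(1) in \<open>auto simp: dual_reflection_def \<delta>_def\<close>)
  then have "dual_reflection (s, True) (dual_reflection (t, True) (dual_reflection (s, True) \<delta>)) = \<delta>"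
    using pres_eq_dual_reflection[OF eq, of \<delta>] by simp
  then have "dual_reflection (t, True) (dual_reflection (s, True) \<delta>) = dual_reflection (s, True) \<delta>"
    by (metis dual_reflection_involution)
  then have "dual_reflection (t, True) (dual_reflection (s, True) \<delta>) t = dual_reflection (s, True) \<delta> t"
    by (rule fun_cong)
  then have "dual_reflection (s, True) \<delta> t = 0"
    by (simp add: dual_reflection_def[of "(t, True)"] bilinear_def)
  then have zero: "bilinear s t = 0" using assms(2) by (simp add: dual_reflection_def \<delta>_def)
  then have st: "{s, t} \<in> E" "cos (pi / m {s, t}) = 0"
    using assms(2) by (auto simp: bilinear_def split: if_splits)
  have "m {s, t} = 2"
  proof (rule ccontr)
    assume "m {s, t} \<noteq> 2"
    then have "2 < m {s, t}" using edge_label[OF st(1)] by linarith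
    then have "cos (pi / m {s, t}) > 0" by (intro cos_gt_zero) (auto simp: field_simps)
    then show False using st(2) by simp
  qed
  then show ?thesis using st by blast
qed

end

section \<open>Reflections and deletion in the Coxeter group\<close>

text \<open>The group \<open>G\<close> is the Coxeter group with the edges of the Dyer graph and all vertex labels
  replaced by \<open>2\<close>.\<close>

locale coxeter_presentation =
  dyer_graph V E f m + presentation V "dyer_relations V E (\<lambda>_. 2) m" G
  for V :: "'v set" and E f m and G (structure)
begin

abbreviation gen :: "'v \<Rightarrow> 'v gword set" where "gen s \<equiv> c [(s, True)]"

definition word :: "'v list \<Rightarrow> 'v gword" where "word xs = map (\<lambda>s. (s, True)) xs"

abbreviation elt :: "'v list \<Rightarrow> 'v gword set" where "elt xs \<equiv> c (word xs)"

lemma word_simps [simp]: "word [] = []" "word (s # xs) = (s, True) # word xs"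
  "word (xs @ ys) = word xs @ word ys"
  by (simp_all add: word_def)

lemma word_gwords [simp]: "word xs \<in> gwords S \<longleftrightarrow> set xs \<subseteq> S"
  by (induction xs) auto

lemma gen_closed: "s \<in> V \<Longrightarrow> gen s \<in> carrier G" by simp

lemma elt_closed: "set xs \<subseteq> V \<Longrightarrow> elt xs \<in> carrier G" by simp

lemma elt_Cons: "s \<in> V \<Longrightarrow> set xs \<subseteq> V \<Longrightarrow> elt (s # xs) = gen s \<otimes> elt xs"
  using c_Cons[of "(s, True)" "word xs"] by simp

lemma elt_append: "set xs \<subseteq> V \<Longrightarrow> set ys \<subseteq> V \<Longrightarrow> elt (xs @ ys) = elt xs \<otimes> elt ys"
  by (simp add: c_append)

lemma gen_square: "s \<in> V \<Longrightarrow> gen s \<otimes> gen s = \<one>"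
proof -
  assume s: "s \<in> V"
  have "(replicate 2 (s, True), []) \<in> cox"
    using s unfolding dyer_relations_def numeral_eq_enat by blast
  then have "c [(s, True), (s, True)] = c []"
    using c_relation s by (simp add: numeral_2_eq_2)
  then show ?thesis using c_Cons[of "(s, True)" "[(s, True)]"] s by (simp add: c_Nil)
qed

lemma gen_cancel: "s \<in> V \<Longrightarrow> x \<in> carrier G \<Longrightarrow> gen s \<otimes> (gen s \<otimes> x) = x"
  by (simp add: m_assoc[symmetric] gen_square)

lemma inv_gen: "s \<in> V \<Longrightarrow> inv (gen s) = gen s"
  using gen_square by (intro inv_equality) auto

lemma positive_word: "w \<in> gwords V \<Longrightarrow> c w = elt (map fst w)"
proof (induction w)
  case (Cons l w)
  then have "c [l] = gen (fst l)" using c_False inv_gen by (cases l; cases "snd l") auto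
  moreover have "set (map fst w) \<subseteq> V" using Cons.prems by (induction w) auto
  ultimately show ?case using Cons c_Cons[of l w] elt_Cons[of "fst l" "map fst w"] by simp
qed simp

text \<open>For a word \<open>s\<^sub>1 \<dots> s\<^sub>k\<close> the list of the reflections \<open>s\<^sub>1 \<dots> s\<^sub>i \<dots> s\<^sub>1\<close>. Multiplying the word from the
  left by the \<open>i\<close>-th of them deletes its \<open>i\<close>-th letter.\<close>

fun reflections :: "'v list \<Rightarrow> 'v gword set list" where
  "reflections [] = []"
| "reflections (s # xs) = gen s # map (\<lambda>r. gen s \<otimes> r \<otimes> gen s) (reflections xs)"

text \<open>The set of reflections occurring an odd number of times depends only on the group element. To
  see this, it is produced from the empty set by an action on the subsets of the group: \<open>s\<close>
  conjugates a set and then toggles \<open>s\<close>.\<close>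

definition flip :: "'v \<times> bool \<Rightarrow> 'v gword set set \<Rightarrow> 'v gword set set" where
  "flip l K = {r \<in> carrier G. (gen (fst l) \<otimes> r \<otimes> gen (fst l) \<in> K) \<noteq> (r = gen (fst l))}"

lemma reflections_closed: "set xs \<subseteq> V \<Longrightarrow> r \<in> set (reflections xs) \<Longrightarrow> r \<in> carrier G"
  by (induction xs arbitrary: r) auto

lemma conj_gen_iff:
  assumes "s \<in> V" "x \<in> carrier G" "y \<in> carrier G"
  shows "gen s \<otimes> x \<otimes> gen s = y \<longleftrightarrow> x = gen s \<otimes> y \<otimes> gen s"
proof -
  have "gen s \<otimes> (gen s \<otimes> z \<otimes> gen s) \<otimes> gen s = z" if "z \<in> carrier G" for z
    using that assms(1) gen_closed by (simp add: m_assoc gen_cancel gen_square)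
  then show ?thesis using assms by metis
qed

lemma count_list_map_conj:
  assumes "s \<in> V" "set rs \<subseteq> carrier G" "r \<in> carrier G"
  shows "count_list (map (\<lambda>r. gen s \<otimes> r \<otimes> gen s) rs) r = count_list rs (gen s \<otimes> r \<otimes> gen s)"
  using assms(2) by (induction rs) (use assms conj_gen_iff in auto)

lemma foldr_flip:
  assumes "set xs \<subseteq> V" "K \<subseteq> carrier G"
  shows "foldr flip (word xs) K =
    {r \<in> carrier G. (inv (elt xs) \<otimes> r \<otimes> elt xs \<in> K) \<noteq> odd (count_list (reflections xs) r)}"
  using assms(1)
proof (induction xs)
  case Nil
  then show ?case using assms(2) by (auto simp: c_Nil)
next
  case (Cons s xs)
  then have s: "s \<in> V" "set xs \<subseteq> V" "set (reflections xs) \<subseteq> carrier G"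
    using reflections_closed by auto
  have inv: "inv (elt xs) \<otimes> (gen s \<otimes> r \<otimes> gen s) \<otimes> elt xs = inv (elt (s # xs)) \<otimes> r \<otimes> elt (s # xs)"
    if "r \<in> carrier G" for r
    using that s elt_closed[OF s(2)] gen_closed[OF s(1)] by (simp only: elt_Cons inv_mult_group inv_gen) (simp add: m_assoc inv_gen)
  have "foldr flip (word (s # xs)) K = flip (s, True) (foldr flip (word xs) K)" by simp
  also have "\<dots> = {r \<in> carrier G. ((inv (elt (s # xs)) \<otimes> r \<otimes> elt (s # xs) \<in> K) \<noteq>
      odd (count_list (reflections xs) (gen s \<otimes> r \<otimes> gen s))) \<noteq> (r = gen s)}"
    unfolding Cons.IH[OF s(2)] flip_def using inv gen_closed[OF s(1)] by auto
  also have "\<dots> = {r \<in> carrier G. (inv (elt (s # xs)) \<otimes> r \<otimes> elt (s # xs) \<in> K) \<noteq>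
      odd (count_list (reflections (s # xs)) r)}"
    using s count_list_map_conj by auto
  finally show ?case .
qed

lemma flip_involution:
  assumes "s \<in> V" "K \<subseteq> carrier G" shows "flip (s, b) (flip (s, b') K) = K"
proof -
  have "gen s \<otimes> (gen s \<otimes> z \<otimes> gen s) \<otimes> gen s = z" if "z \<in> carrier G" for z
    using that conj_gen_iff[OF assms(1), of "gen s \<otimes> z \<otimes> gen s" z] assms(1) by simp
  note conj_conj = this
  have conj_eq: "gen s \<otimes> z \<otimes> gen s = gen s \<longleftrightarrow> z = gen s" if "z \<in> carrier G" for z
    using conj_gen_iff[OF assms(1) that, of "gen s"] assms(1) by (simp add: gen_square)
  have "z \<in> flip (s, b) (flip (s, b') K) \<longleftrightarrow> z \<in> K" if "z \<in> carrier G" for z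
  proof -
    have "gen s \<otimes> z \<otimes> gen s \<in> carrier G" using that assms(1) by simp
    then show ?thesis using that
      by (simp only: flip_def mem_Collect_eq fst_conv conj_conj[OF that] conj_eq[OF that]) blast
  qed
  then show ?thesis using assms(2) unfolding flip_def by blast
qed

lemma pow_shift:
  assumes "x \<in> carrier G" "y \<in> carrier G"
  shows "x \<otimes> (y \<otimes> x) [^] (n::nat) = (x \<otimes> y) [^] n \<otimes> x"
proof (induction n)
  case (Suc n)
  have "x \<otimes> (y \<otimes> x) [^] Suc n = (x \<otimes> (y \<otimes> x) [^] n) \<otimes> (y \<otimes> x)"
    using assms by (simp add: m_assoc)
  then show ?case using assms Suc by (simp add: m_assoc)
qed (use assms in simp)

abbreviation alt :: "'v \<Rightarrow> 'v \<Rightarrow> nat \<Rightarrow> 'v list" where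
  "alt u v n \<equiv> map fst (alternating u v n)"

lemma word_alt: "word (alt u v n) = alternating u v n"
  by (induction n arbitrary: u v) auto

lemma set_alt: "u \<in> V \<Longrightarrow> v \<in> V \<Longrightarrow> set (alt u v n) \<subseteq> V"
  by (induction n arbitrary: u v) auto

text \<open>Reading reflections from the left end gives a formula that does not depend on the parity of
  the length.\<close>

lemma reflections_alt:
  assumes "u \<in> V" "v \<in> V"
  shows "reflections (alt u v n) = map (\<lambda>j. (gen u \<otimes> gen v) [^] j \<otimes> gen u) [0..<n]"
  using assms
proof (induction n arbitrary: u v)
  case (Suc n)
  have step: "gen u \<otimes> ((gen v \<otimes> gen u) [^] j \<otimes> gen v) \<otimes> gen u = (gen u \<otimes> gen v) [^] Suc j \<otimes> gen u" for j
  proof -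
    have "gen u \<otimes> ((gen v \<otimes> gen u) [^] j \<otimes> gen v) \<otimes> gen u = (gen u \<otimes> (gen v \<otimes> gen u) [^] j) \<otimes> gen v \<otimes> gen u"
      using Suc.prems by (simp add: m_assoc)
    then show ?thesis using Suc.prems by (simp add: pow_shift m_assoc)
  qed
  have "reflections (alt u v (Suc n)) = gen u # map (\<lambda>j. (gen u \<otimes> gen v) [^] Suc j \<otimes> gen u) [0..<n]"
    using Suc.IH[of v u] Suc.prems by (simp add: step del: nat_pow_Suc)
  also have "\<dots> = map (\<lambda>j. (gen u \<otimes> gen v) [^] j \<otimes> gen u) (0 # map Suc [0..<n])"
    using Suc.prems by (simp del: nat_pow_Suc)
  also have "0 # map Suc [0..<n] = [0..<Suc n]" by (metis map_Suc_upt upt_conv_Cons zero_less_Suc)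
  finally show ?case .
qed simp

lemma elt_alt_quotient:
  assumes "u \<in> V" "v \<in> V"
  shows "elt (alt u v n) \<otimes> inv (elt (alt v u n)) = (gen u \<otimes> gen v) [^] n"
  using assms
proof (induction n arbitrary: u v)
  case (Suc n)
  let ?a = "elt (alt v u n)" and ?b = "elt (alt u v n)"
  have carr: "?a \<in> carrier G" "?b \<in> carrier G" "gen u \<in> carrier G" "gen v \<in> carrier G"
    using Suc.prems set_alt elt_closed by auto
  have "elt (alt u v (Suc n)) = gen u \<otimes> ?a" "elt (alt v u (Suc n)) = gen v \<otimes> ?b"
    using elt_Cons[of u "alt v u n"] elt_Cons[of v "alt u v n"] Suc.prems set_alt by auto
  then have "elt (alt u v (Suc n)) \<otimes> inv (elt (alt v u (Suc n))) = (gen u \<otimes> (?a \<otimes> inv ?b)) \<otimes> gen v"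
    using carr Suc.prems by (simp add: inv_mult_group inv_gen m_assoc)
  also have "\<dots> = (gen u \<otimes> gen v) [^] Suc n"
    using Suc.IH[of v u] Suc.prems carr by (simp add: pow_shift m_assoc)
  finally show ?case .
qed (simp add: c_Nil)

text \<open>Both sides of a braid relation yield the same reflections in opposite order, because the
  \<open>m\<close>-th power of \<open>u v\<close> is trivial.\<close>

lemma reflections_braid:
  assumes uv: "{u, v} \<in> E"
  shows "reflections (alt u v (m {u, v})) = rev (reflections (alt v u (m {u, v})))"
proof -
  define n where "n = m {u, v}"
  define x where "x = gen u \<otimes> gen v"
  have V: "u \<in> V" "v \<in> V" using edgeD[OF uv] by auto
  have carr: "gen u \<in> carrier G" "gen v \<in> carrier G" "x \<in> carrier G" using V by (auto simp: x_def)
  have "(alternating u v n, alternating v u n) \<in> cox" using uv by (auto simp: dyer_relations_def n_def)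
  then have "elt (alt u v n) = elt (alt v u n)"
    unfolding word_alt using V alternating_gwords by (intro c_relation) auto
  then have x_pow: "x [^] n = \<one>"
    using elt_alt_quotient[OF V, of n] elt_closed[OF set_alt] V by (simp add: x_def)
  have vu: "gen v \<otimes> gen u = inv x" using V carr by (simp add: x_def inv_mult_group inv_gen)
  have "x [^] i \<otimes> gen u = (gen v \<otimes> gen u) [^] (n - Suc i) \<otimes> gen v" if "i < n" for i
  proof -
    have "x [^] Suc i \<otimes> x [^] (n - Suc i) = \<one>"
      using that x_pow carr by (simp only: nat_pow_mult) simp
    then have "inv (x [^] (n - Suc i)) = x [^] Suc i" using carr by (intro inv_equality) auto
    then have "(gen v \<otimes> gen u) [^] (n - Suc i) \<otimes> gen v = x [^] i \<otimes> (x \<otimes> gen v)"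
      using carr by (simp add: vu nat_pow_inv m_assoc)
    also have "x \<otimes> gen v = gen u" using carr V by (simp add: x_def m_assoc gen_square)
    finally show ?thesis by simp
  qed
  then have "reflections (alt u v n) = rev (reflections (alt v u n))"
    unfolding reflections_alt[OF V] reflections_alt[OF V(2,1)]
    by (intro nth_equalityI) (auto simp: rev_nth x_def)
  then show ?thesis by (simp add: n_def)
qed

lemma reflection_parity:
  assumes "set xs \<subseteq> V" "set ys \<subseteq> V" "elt xs = elt ys" "r \<in> carrier G"
  shows "odd (count_list (reflections xs) r) \<longleftrightarrow> odd (count_list (reflections ys) r)"
proof -
  have "pres_eq V cox (word xs) (word ys)" using assms c_eq_iff by auto
  then have "foldr flip (word xs) {} = foldr flip (word ys) {}"
  proof (rule pres_eq_foldr[where Y = "Pow (carrier G)"])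
    fix r r' K assume "(r, r') \<in> cox" "K \<in> Pow (carrier G)" and r: "r \<in> gwords V"
    from this(1) show "foldr flip r K = foldr flip r' K"
    proof (cases rule: dyer_relationE)
      case (power s n)
      then have "r = [(s, True), (s, True)]" by (auto simp: numeral_eq_enat numeral_2_eq_2)
      then show ?thesis using flip_involution \<open>K \<in> _\<close> power by simp
    next
      case (braid u v)
      have V: "u \<in> V" "v \<in> V" using edgeD[OF braid(1)] by auto
      have "c r = c r'"
        using c_relation[OF \<open>(r, r') \<in> cox\<close>] braid V by (simp add: alternating_gwords)
      then have "elt (alt u v (m {u, v})) = elt (alt v u (m {u, v}))" using braid by (simp add: word_alt)
      then show ?thesis
        using foldr_flip[OF set_alt[OF V]] foldr_flip[OF set_alt[OF V(2,1)]] \<open>K \<in> _\<close>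
          reflections_braid[OF braid(1)] braid by (simp add: word_alt)
    qed
  next
    show "flip (s, b) K \<in> Pow (carrier G)" for s b K by (auto simp: flip_def)
    show "flip (s, b) (flip (s, \<not> b) K) = K" if "s \<in> V" "K \<in> Pow (carrier G)" for s b K
      using that flip_involution by blast
  qed simp
  then show ?thesis using assms(4) unfolding foldr_flip[OF assms(1) empty_subsetI]
      foldr_flip[OF assms(2) empty_subsetI] by blast
qed

lemma reflections_append:
  assumes "set xs \<subseteq> V" "s \<in> V"
  shows "reflections (xs @ [s]) = reflections xs @ [elt xs \<otimes> gen s \<otimes> inv (elt xs)]"
  using assms(1)
proof (induction xs)
  case (Cons t xs)
  then have "gen t \<otimes> (elt xs \<otimes> gen s \<otimes> inv (elt xs)) \<otimes> gen t = elt (t # xs) \<otimes> gen s \<otimes> inv (elt (t # xs))"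
    using assms(2) elt_closed[of xs] gen_closed[of t] by (simp only: elt_Cons inv_mult_group inv_gen set_simps insert_subset) (simp add: m_assoc inv_gen)
  then show ?case using Cons by simp
qed (use assms in \<open>simp add: c_Nil\<close>)

lemma reflection_in_parabolic:
  assumes "set xs \<subseteq> V" "r \<in> set (reflections xs)"
  shows "\<exists>q. set q \<subseteq> set xs \<and> r = elt q"
  using assms
proof (induction xs arbitrary: r)
  case (Cons s xs)
  then have s: "s \<in> V" "set xs \<subseteq> V" by auto
  consider "r = gen s" | r' where "r' \<in> set (reflections xs)" "r = gen s \<otimes> r' \<otimes> gen s"
    using Cons.prems by auto
  then show ?case
  proof cases
    case 1
    then show ?thesis by (intro exI[of _ "[s]"]) simp
  next
    case 2
    obtain q where q: "set q \<subseteq> set xs" "r' = elt q" using Cons.IH[OF s(2) 2(1)] by blast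
    then have "elt (s # q @ [s]) = gen s \<otimes> (r' \<otimes> gen s)"
      using s elt_append[of q "[s]"] elt_Cons[of s "q @ [s]"] by auto
    then show ?thesis using 2 q s elt_closed[of q] by (intro exI[of _ "s # q @ [s]"]) (auto simp: m_assoc)
  qed
qed simp

lemma reflection_deletes:
  assumes "set xs \<subseteq> V" "r \<in> set (reflections xs)"
  shows "\<exists>ys. set ys \<subseteq> set xs \<and> length ys < length xs \<and> r \<otimes> elt xs = elt ys"
  using assms
proof (induction xs arbitrary: r)
  case (Cons s xs)
  then have s: "s \<in> V" "set xs \<subseteq> V" by auto
  consider "r = gen s" | r' where "r' \<in> set (reflections xs)" "r = gen s \<otimes> r' \<otimes> gen s"
    using Cons.prems by auto
  then show ?case
  proof cases
    case 1
    then show ?thesis using s elt_closed elt_Cons gen_cancel by (intro exI[of _ xs]) auto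
  next
    case 2
    obtain ys where ys: "set ys \<subseteq> set xs" "length ys < length xs" "r' \<otimes> elt xs = elt ys"
      using Cons.IH[OF s(2) 2(1)] by blast
    have "r' \<in> carrier G" using reflections_closed[OF s(2) 2(1)] .
    then have "r \<otimes> elt (s # xs) = gen s \<otimes> (r' \<otimes> elt xs)"
      using 2 s elt_closed[OF s(2)] gen_closed[OF s(1)] elt_Cons[OF s] by (simp add: m_assoc gen_cancel del: word_simps)
    then show ?thesis using ys s elt_Cons[of s ys] by (intro exI[of _ "s # ys"]) auto
  qed
qed simp

text \<open>Minimality is taken among words in \<open>A\<close> alone. Deletion stays inside \<open>A\<close>, so this is
  enough for exchange arguments.\<close>

definition shortest :: "'v set \<Rightarrow> 'v list \<Rightarrow> bool" where
  "shortest A xs \<longleftrightarrow> set xs \<subseteq> A \<and> (\<forall>ys. set ys \<subseteq> A \<longrightarrow> elt ys = elt xs \<longrightarrow> length xs \<le> length ys)"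

lemma shortest_tl:
  assumes "A \<subseteq> V" "shortest A (t # xs)" shows "shortest A xs"
  unfolding shortest_def
proof (intro conjI allI impI)
  fix ys assume ys: "set ys \<subseteq> A" "elt ys = elt xs"
  have "elt (t # ys) = elt (t # xs)"
    using elt_Cons[of t ys] elt_Cons[of t xs] ys assms by (force simp: shortest_def)
  then have "length (t # xs) \<le> length (t # ys)"
    using assms(2) ys(1) unfolding shortest_def by (metis insert_subset list.simps(15))
  then show "length xs \<le> length ys" by simp
qed (use assms in \<open>auto simp: shortest_def\<close>)

text \<open>If the first reflection \<open>t\<close> occurred again further on, then \<open>t x\<close> could be rewritten by deleting a
  letter of \<open>x\<close>, against minimality.\<close>

lemma shortest_hd_count:
  assumes "A \<subseteq> V" "shortest A (t # xs)"
  shows "count_list (reflections (t # xs)) (gen t) = 1"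
proof -
  have t: "t \<in> V" "set xs \<subseteq> V" using assms by (auto simp: shortest_def)
  have "gen t \<notin> set (reflections xs)"
  proof
    assume "gen t \<in> set (reflections xs)"
    then obtain ys where "set ys \<subseteq> set xs" "length ys < length xs" "elt (t # xs) = elt ys"
      using reflection_deletes[OF t(2)] elt_Cons[OF t] by metis
    then show False using assms(2) unfolding shortest_def by (force simp del: word_simps)
  qed
  moreover have "gen t \<otimes> gen t \<otimes> gen t = gen t" using t by (simp add: gen_square)
  moreover have "set (reflections xs) \<subseteq> carrier G" using reflections_closed[OF t(2)] by blast
  ultimately show ?thesis using count_list_map_conj[OF t(1), of "reflections xs" "gen t"] t
    by (simp add: count_list_0_iff)
qed

text \<open>The words \<open>s z\<close> and \<open>z s\<close> represent the same element. The first, for \<open>z\<close> starting with \<open>t\<close>,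
  crosses \<open>s t s\<close> exactly once; so the second crosses it too, and as its last reflection is
  \<open>z s z\<inverse> = s\<close>, already \<open>z\<close> crosses \<open>s t s\<close>. Then \<open>s t s\<close> is a product of letters of \<open>z\<close>, so that \<open>s\<close> and
  \<open>t\<close> are joined by an edge of label \<open>2\<close>. They commute, \<open>t\<close> cancels from the equation
  \<open>s z = z s\<close>, and the rest of \<open>z\<close> follows by induction.\<close>

lemma commuting_generator_joined:
  assumes "A \<subseteq> V" "s \<in> V" "shortest A xs" "s \<notin> set xs" "gen s \<otimes> elt xs = elt xs \<otimes> gen s"
  shows "\<forall>t\<in>set xs. {s, t} \<in> E \<and> m {s, t} = 2"
  using assms(3-5)
proof (induction xs)
  case (Cons t xs)
  have V: "t \<in> V" "set (t # xs) \<subseteq> V" "set xs \<subseteq> V" using Cons.prems(1) assms(1) by (auto simp: shortest_def)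
  have carr: "gen s \<in> carrier G" "gen t \<in> carrier G" "elt xs \<in> carrier G" "elt (t # xs) \<in> carrier G"
    using V assms(2) by auto
  define r where "r = gen s \<otimes> gen t \<otimes> gen s"
  have r: "r \<in> carrier G" "gen s \<otimes> r \<otimes> gen s = gen t"
    using conj_gen_iff[OF assms(2) carr(2), of r] carr by (auto simp: r_def)
  have r_word: "r = c [(s, True), (t, True), (s, True)]"
    using V assms(2) c_Cons[of "(s, True)" "[(t, True), (s, True)]"] c_Cons[of "(t, True)" "[(s, True)]"]
    by (simp add: r_def m_assoc)
  have "\<exists>q. set q \<subseteq> set (t # xs) \<and> r = elt q"
  proof (cases "r = gen s")
    \<comment> \<open>Different vertices have not been shown to be different elements; if \<open>s\<close> and \<open>t\<close>
      coincide, \<open>s t s\<close> is \<open>t\<close>.\<close>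
    case True
    then have "gen t = gen s" using r assms(2) by (simp add: gen_square)
    then show ?thesis using True by (intro exI[of _ "[t]"]) simp
  next
    case False
    have eq: "elt (s # t # xs) = elt ((t # xs) @ [s])"
      using elt_Cons[OF assms(2) V(2)] elt_append[OF V(2), of "[s]"] Cons.prems(3) assms(2) by simp
    have fix_s: "elt (t # xs) \<otimes> gen s \<otimes> inv (elt (t # xs)) = gen s"
      using Cons.prems(3)[symmetric] by (rule iffD2[OF commute_iff_conj[OF carr(4) carr(1)]])
    define rs where "rs = reflections (t # xs)"
    have "set rs \<subseteq> carrier G" unfolding rs_def by (intro subsetI reflections_closed[OF V(2)])
    then have "count_list (map (\<lambda>r. gen s \<otimes> r \<otimes> gen s) rs) r = count_list rs (gen t)"
      using count_list_map_conj[OF assms(2) _ r(1)] r(2) by simp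
    also have "\<dots> = 1"
      unfolding rs_def by (rule shortest_hd_count[OF assms(1) Cons.prems(1)])
    finally have "count_list (reflections (s # t # xs)) r = 1"
      using False unfolding reflections.simps(2)[of s] rs_def[symmetric] by simp
    moreover have "set (s # t # xs) \<subseteq> V" "set ((t # xs) @ [s]) \<subseteq> V" using V assms(2) by auto
    ultimately have "odd (count_list (reflections ((t # xs) @ [s])) r)"
      using reflection_parity[OF _ _ eq r(1)] by simp
    then have "odd (count_list (reflections (t # xs)) r)"
      unfolding reflections_append[OF V(2) assms(2)] fix_s rs_def[symmetric] using False by simp
    then have "r \<in> set (reflections (t # xs))" by (metis count_list_0_iff even_zero)
    then show ?thesis by (rule reflection_in_parabolic[OF V(2)])
  qed
  then obtain q where q: "set q \<subseteq> set (t # xs)" "r = elt q" by blast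
  have "pres_eq V cox [(s, True), (t, True), (s, True)] (word q)"
    using q V assms(2) by (subst c_eq_iff[symmetric]) (auto simp: r_word)
  then have joined: "{s, t} \<in> E \<and> m {s, t} = 2"
    using conjugate_in_parabolic_imp_joined[of s "set (t # xs)" t "word q"] q Cons.prems(2) by auto
  have "c [(s, True), (t, True)] = c [(t, True), (s, True)]"
    using c_eqI[OF edge_2_commute] joined by blast
  then have comm: "gen s \<otimes> gen t = gen t \<otimes> gen s"
    using V assms(2) c_Cons[of "(s, True)" "[(t, True)]"] c_Cons[of "(t, True)" "[(s, True)]"] by simp
  have "gen t \<otimes> (gen s \<otimes> elt xs) = gen t \<otimes> (elt xs \<otimes> gen s)"
    using Cons.prems(3) carr comm elt_Cons[OF V(1,3)] by (simp add: m_assoc[symmetric] del: word_simps)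
  then have "gen s \<otimes> elt xs = elt xs \<otimes> gen s" using carr by simp
  then have "\<forall>t\<in>set xs. {s, t} \<in> E \<and> m {s, t} = 2"
    using Cons.IH shortest_tl[OF assms(1) Cons.prems(1)] Cons.prems(2) by simp
  then show ?case using joined by simp
qed simp

lemma central_in_proper_parabolic_trivial:
  assumes A: "A \<subseteq> V" "A \<noteq> V" and w: "w \<in> gwords A"
    and central: "\<And>s. s \<in> V \<Longrightarrow> gen s \<otimes> c w = c w \<otimes> gen s"
    and irreducible: "\<not> dyer_reducible V E m"
  shows "c w = \<one>"
proof -
  have wV: "w \<in> gwords V" using gwords_mono[OF A(1) w] .
  have "set (map fst w) \<subseteq> A" using w by (induction w) auto
  then obtain xs where xs: "set xs \<subseteq> A" "elt xs = c w"
    and least: "\<And>ys. set ys \<subseteq> A \<Longrightarrow> elt ys = c w \<Longrightarrow> length xs \<le> length ys"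
    using ex_has_least_nat[of "\<lambda>xs. set xs \<subseteq> A \<and> elt xs = c w" "map fst w" length] positive_word[OF wV]
    by metis
  then have short: "shortest A xs" by (auto simp: shortest_def)
  have "xs = []"
  proof (rule ccontr)
    assume "xs \<noteq> []"
    have "{s, t} \<in> E \<and> m {s, t} = 2" if "t \<in> set xs" "s \<in> V - set xs" for s t
      using commuting_generator_joined[OF A(1) _ short, of s] that xs central by simp
    then have "dyer_reducible V E m"
      using joined_imp_reducible[of "set xs"] \<open>xs \<noteq> []\<close> xs A by blast
    then show False using irreducible by simp
  qed
  then show ?thesis using xs by (simp add: c_Nil)
qed

end

section \<open>The centre of an irreducible Dyer group\<close>

context dyer_graph
begin

lemma irreducible_imp_nonadjacent:
  assumes "\<not> dyer_reducible V E m" "v \<in> V" "3 \<le> f v" "V \<noteq> {v}"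
  obtains u where "u \<in> V" "u \<noteq> v" "{u, v} \<notin> E"
proof -
  have "\<not> (\<forall>u\<in>V - {v}. {u, v} \<in> E)"
    using joined_imp_reducible[of "{v}"] label_compatible[of _ v] assms by auto
  then show ?thesis using that by blast
qed

text \<open>The vertex \<open>v\<close> is big. If \<open>u\<close> has label \<open>2\<close>, commutation passes to the Coxeter group and gives
  \<open>u v u = v\<close> there.\<close>

lemma nonadjacent_not_commute:
  assumes u: "u \<in> V" "u \<noteq> v" "{u, v} \<notin> E" and v: "v \<in> V" "3 \<le> f v"
  shows "\<not> pres_eq V (dyer_relations V E f m) [(u, True), (v, True)] [(v, True), (u, True)]"
proof (cases "3 \<le> f u")
  case True
  then show ?thesis using nonadjacent_big_not_commute assms by blast
next
  case False
  then have "u \<in> V2" using label_cases u by blast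
  show ?thesis
  proof
    assume "pres_eq V (dyer_relations V E f m) [(u, True), (v, True)] [(v, True), (u, True)]"
    then have comm: "pres_eq V cox [(u, True), (v, True)] [(v, True), (u, True)]"
      using commuting_in_coxeter_group[OF v, of "[(u, True)]"] \<open>u \<in> V2\<close> by simp
    define G where "G = presented_group V cox"
    interpret C: coxeter_presentation V E f m G by unfold_locales (simp add: G_def)
    have "C.c [(u, True), (v, True), (u, True)] = C.c ([(u, True), (v, True)] @ [(u, True)])" by simp
    also have "\<dots> = C.c ([(v, True), (u, True)] @ [(u, True)])"
      using C.c_append[of "[(u, True), (v, True)]" "[(u, True)]"]
        C.c_append[of "[(v, True), (u, True)]" "[(u, True)]"] C.c_eqI[OF comm] u v by simp
    also have "\<dots> = C.gen v"
      using C.elt_append[of "[v]" "[u, u]"] C.elt_append[of "[u]" "[u]"] u v by (simp add: C.gen_square)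
    finally have "pres_eq V cox [(u, True), (v, True), (u, True)] [(v, True)]"
      using u v by (subst C.c_eq_iff[symmetric]) auto
    then show False
      using conjugate_in_parabolic_imp_joined[of u "{v}" v "[(v, True)]"] u by auto
  qed
qed

text \<open>The big vertices are deleted one at a time, each time from a word that is still central. The
  resulting word is then moved to the Coxeter group, where it is trivial, and back.\<close>

lemma central_word_trivial:
  assumes irreducible: "\<not> dyer_reducible V E m" and v0: "v0 \<in> V" "f v0 \<noteq> 2" "V \<noteq> {v0}"
    and w: "w \<in> gwords V"
    and central: "\<And>g. g \<in> gwords V \<Longrightarrow> pres_eq V (dyer_relations V E f m) (w @ g) (g @ w)"
  shows "pres_eq V (dyer_relations V E f m) w []"
proof -
  let ?eq = "pres_eq V (dyer_relations V E f m)"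
  have big: "V - V2 = {v \<in> V. 3 \<le> f v}"
    using label_cases by (auto simp: numeral_eq_enat)
  have transfer: "?eq (w' @ g) (g @ w')" if "?eq w w'" "g \<in> gwords V" for w' g
    using pres_eq_append[OF pres_eq.sym[OF that(1)] pres_eq.refl[OF that(2)]] central[OF that(2)]
      pres_eq_append[OF pres_eq.refl[OF that(2)] that(1)] by (blast intro: pres_eq.trans)
  have "?eq w (restrict_word (V - F) w)" if "finite F" "F \<subseteq> V - V2" for F
    using that
  proof (induction F)
    case empty
    have "restrict_word V w = w" using restrict_word_id[OF w] .
    then show ?case using w by (simp add: pres_eq.refl)
  next
    case (insert v F)
    let ?w = "restrict_word (V - F) w"
    have v: "v \<in> V" "3 \<le> f v" "V \<noteq> {v}" using insert big v0 by auto
    have ww: "?eq w ?w" and "?w \<in> gwords V" using insert w by auto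
    obtain u where u: "u \<in> V" "u \<noteq> v" "{u, v} \<notin> E"
      using irreducible_imp_nonadjacent[OF irreducible v] .
    have "?eq ?w (restrict_word (V - {v}) ?w)"
      using central_avoids_big_vertex[OF v(1,2) \<open>?w \<in> _\<close> transfer[OF ww] u(1,2)] nonadjacent_not_commute[OF u v(1,2)]
      by blast
    also have "restrict_word (V - {v}) ?w = restrict_word (V - insert v F) w"
      by (auto simp: restrict_word_def intro: filter_cong)
    finally show ?case using ww by (blast intro: pres_eq.trans)
  qed
  from this[of "V - V2"] have "?eq w (restrict_word (V - (V - V2)) w)" using finite_vertices by simp
  moreover have "V - (V - V2) = V2" by blast
  ultimately have ww: "?eq w (restrict_word V2 w)" by simp
  let ?w = "restrict_word V2 w"
  have w2: "?w \<in> gwords V" "?w \<in> gwords V2"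
    using w restrict_word_gwords[OF w, of V2] by (auto simp: Int_absorb1)
  define G where "G = presented_group V cox"
  interpret C: coxeter_presentation V E f m G by unfold_locales (simp add: G_def)
  have "C.gen s \<otimes>\<^bsub>G\<^esub> C.c ?w = C.c ?w \<otimes>\<^bsub>G\<^esub> C.gen s" if s: "s \<in> V" for s
  proof -
    have comm_s: "?eq (?w @ [(s, True)]) ((s, True) # ?w)" using transfer[OF ww, of "[(s, True)]"] s by simp
    have "pres_eq V cox (?w @ [(s, True)]) ((s, True) # ?w)"
    proof (cases "s \<in> V2")
      case True
      then show ?thesis
        using pres_eq_restrict[OF comm_s, of V2 "\<lambda>_. 2"] edge_label_outside restrict_word_id[OF w2(2)]
        by simp
    next
      case False
      then show ?thesis using commuting_in_coxeter_group[OF _ _ w2(2) comm_s] big s by blast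
    qed
    from C.c_eqI[OF this] show ?thesis
      using C.c_append[of ?w "[(s, True)]"] C.c_Cons[of "(s, True)" ?w] w2 s by simp
  qed
  moreover have "V2 \<noteq> V" using v0 by blast
  ultimately have "C.c ?w = C.c []"
    using C.central_in_proper_parabolic_trivial[OF _ _ w2(2) _ irreducible] by (auto simp: C.c_Nil)
  then have "pres_eq V cox ?w []" using w2 by (simp add: C.c_eq_iff)
  from pres_eq_restrict[OF this, of V2 f] have "?eq ?w []"
    using edge_label_outside restrict_word_id[OF w2(2)] by simp
  then show ?thesis using ww by (blast intro: pres_eq.trans)
qed

end

theorem theorem1:
  fixes V :: "'v set" and E :: "'v set set" and f :: "'v \<Rightarrow> enat" and m :: "'v set \<Rightarrow> nat"
  assumes "dyer_graph V E f m"
    and "dyer_irreducible V E m"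
    and "\<exists>v\<in>V. f v \<noteq> 2"
  shows "((\<exists>v. V = {v}) \<and> cyclic_group (dyer_group V E f m)) \<or>
         group_centre (dyer_group V E f m) = {\<one>\<^bsub>dyer_group V E f m\<^esub>}"
proof -
  interpret dyer_graph V E f m by fact
  let ?G = "dyer_group V E f m"
  interpret D: presentation V "dyer_relations V E f m" ?G
    by unfold_locales (simp add: dyer_group_def)
  obtain v0 where v0: "v0 \<in> V" "f v0 \<noteq> 2" using assms(3) by blast
  show ?thesis
  proof (cases "V = {v0}")
    case True
    let ?x = "D.c [(v0, True)]"
    have x: "?x \<in> carrier ?G" using v0 by simp
    have "D.c w \<in> range (\<lambda>n::int. ?x [^]\<^bsub>?G\<^esub> n)" if "w \<in> gwords V" for w
      using that
    proof (induction w)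
      case Nil
      show ?case by (intro range_eqI[of _ _ 0]) (simp add: D.c_Nil)
    next
      case (Cons l w)
      then obtain n :: int where n: "D.c w = ?x [^]\<^bsub>?G\<^esub> n" by auto
      have "fst l \<in> V" using Cons.prems by simp
      then have "fst l = v0" using True by blast
      then obtain b where l: "l = (v0, b)" by (cases l) simp
      have "D.c [l] = ?x [^]\<^bsub>?G\<^esub> (if b then 1 else - 1 :: int)"
        using D.c_False[OF v0(1)] x by (cases b) (simp_all add: l D.int_pow_neg)
      then have "D.c (l # w) = ?x [^]\<^bsub>?G\<^esub> ((if b then 1 else - 1) + n)"
        using Cons.prems D.c_Cons[of l w] n x by (simp only: D.int_pow_mult gwords_Cons)
      then show ?case by (rule range_eqI)
    qed
    then have "carrier ?G \<subseteq> range (\<lambda>n::int. ?x [^]\<^bsub>?G\<^esub> n)"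
      unfolding D.carrier_eq by blast
    then have "carrier ?G = range (\<lambda>n::int. ?x [^]\<^bsub>?G\<^esub> n)"
      using D.int_pow_closed[OF x] by blast
    then show ?thesis using x True D.cyclic_group by blast
  next
    case False
    have "z = \<one>\<^bsub>?G\<^esub>" if z: "z \<in> group_centre ?G" for z
    proof -
      obtain w where w: "w \<in> gwords V" "z = D.c w"
        using z by (auto simp: group_centre_def D.carrier_eq)
      have "pres_eq V (dyer_relations V E f m) (w @ g) (g @ w)" if g: "g \<in> gwords V" for g
        using z w g by (subst D.c_eq_iff[symmetric]) (auto simp: group_centre_def D.c_append)
      then have "pres_eq V (dyer_relations V E f m) w []"
        using central_word_trivial[OF _ v0 False w(1)] assms(2) by (simp add: dyer_irreducible_def)
      then show ?thesis using D.c_eqI w by (simp add: D.c_Nil)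
    qed
    moreover have "\<one>\<^bsub>?G\<^esub> \<in> group_centre ?G" by (simp add: group_centre_def)
    ultimately show ?thesis by blast
  qed
qed

end
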